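(* Let $X_1,X_2,\ldots$ be i.i.d. copies of an absolutely continuous real-valued random variable $X$ with distribution function $F$. Assume that (A1) $X$ possesses a finite mean $\mu$ and variance $\sigma^2$, and (A2) the probability density function of $X$ is continuous in a neighbourhood of $\mu$. Then, under the null hypothesis $H_0$ that $F$ is symmetric, as $n\to\infty$, $-2\log\mathcal{R}$ converges in distribution to $\chi^2_1$ (the chi-square distribution with one degree of freedom), where $\mathcal{R}$ is the jackknife empirical likelihood ratio defined in the context.
   Context: $F$ is called symmetric if there is a point $m\in\mathbb{R}$ such that $F(m+x)=1-F(m-x)$ for all $x\in\mathbb{R}$. Define the $U$-statistic $$\widehat{\Delta}_n=\binom{n}{3}^{-1}\sum_{1\le k<j<i\le n}h(X_i,X_j,X_k),$$ with symmetric kernel $$h(x_1,x_2,x_3)=\frac13\left(\frac{3\max(x_1,x_2,x_3)+3\min(x_1,x_2,x_3)}{2}-(x_1+x_2+x_3)\right).$$ The jackknife pseudo-values are $$\widehat{\mathcal{V}}_i=n\widehat{\Delta}_n-(n-1)\widehat{\Delta}^{(-i)}_{n-1},\qquad i=1,\ldots,n,$$ where $\widehat{\Delta}^{(-i)}_{n-1}$ is the same $U$-statistic computed from the sample $X_1,\ldots,X_n$ with the $i$-th observation excluded. The jackknife empirical likelihood ratio is $$\mathcal{R}=\max\left\{\prod_{i=1}^n np_i:\ \sum_{i=1}^n p_i=1,\ p_i\ge0,\ \sum_{i=1}^n p_i\widehat{\mathcal{V}}_i=0\right\}.$$ *)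

theory Defs
  imports "HOL-Probability.Probability"
begin

definition symmetric_cdf :: "(real \<Rightarrow> real) \<Rightarrow> bool" where
  "symmetric_cdf F \<longleftrightarrow> (\<exists>m. \<forall>x. F (m + x) = 1 - F (m - x))"

definition kern :: "real \<Rightarrow> real \<Rightarrow> real \<Rightarrow> real" where
  "kern x y z =
     (1 / 3) * ((3 * max x (max y z) + 3 * min x (min y z)) / 2 - (x + y + z))"

text \<open>The sample is a family \<open>x\<close> indexed by natural numbers, observed on the finite index
  set \<open>A\<close>; deleting an observation means removing its index from \<open>A\<close>.\<close>

definition U_stat :: "nat set \<Rightarrow> (nat \<Rightarrow> real) \<Rightarrow> real" where
  "U_stat A x =
     (\<Sum>(i, j, k) \<in> {(i, j, k). i \<in> A \<and> j \<in> A \<and> k \<in> A \<and> k < j \<and> j < i}. kern (x i) (x j) (x k))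
       / real (card A choose 3)"

definition pseudo_value :: "nat \<Rightarrow> (nat \<Rightarrow> real) \<Rightarrow> nat \<Rightarrow> real" where
  "pseudo_value n x i =
     real n * U_stat {1..n} x - (real n - 1) * U_stat ({1..n} - {i}) x"

definition el_feasible :: "nat \<Rightarrow> (nat \<Rightarrow> real) \<Rightarrow> (nat \<Rightarrow> real) set" where
  "el_feasible n v =
     {p. (\<Sum>i = 1..n. p i) = 1 \<and> (\<forall>i \<in> {1..n}. p i \<ge> 0) \<and> (\<Sum>i = 1..n. p i * v i) = 0}"

text \<open>If no weight vector is feasible, i.e. \<open>0\<close> is outside the convex hull of the
  values \<open>v i\<close>, the ratio is \<open>0\<close> by the usual convention. Otherwise the supremum
  is a maximum, see \<open>el_ratio_attained\<close> below.\<close>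

definition el_ratio :: "nat \<Rightarrow> (nat \<Rightarrow> real) \<Rightarrow> real" where
  "el_ratio n v =
     (if el_feasible n v = {} then 0 else (SUP p \<in> el_feasible n v. \<Prod>i = 1..n. real n * p i))"

definition jel_ratio :: "nat \<Rightarrow> (nat \<Rightarrow> real) \<Rightarrow> real" where
  "jel_ratio n x = el_ratio n (pseudo_value n x)"

text \<open>The value is extended real since \<open>-2 log 0 = \<infinity>\<close>, whereas \<open>ln 0 = 0\<close> on the type \<open>real\<close>.\<close>

definition neg2_log :: "real \<Rightarrow> ereal" where
  "neg2_log r = (if r = 0 then \<infinity> else ereal (- 2 * ln r))"

text \<open>The law of the sum of the squares of \<open>k\<close> independent standard normal variables.\<close>

definition chi_square :: "nat \<Rightarrow> real measure" where
  "chi_square k =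
     distr (PiM {..<k} (\<lambda>_. density lborel std_normal_density)) borel (\<lambda>z. \<Sum>i<k. (z i)\<^sup>2)"

text \<open>The limit law lives on the reals, so convergence of the distribution functions
  at real arguments already forces the probability of the value \<open>\<infinity>\<close> to vanish.\<close>

definition conv_in_distr :: "'a measure \<Rightarrow> (nat \<Rightarrow> 'a \<Rightarrow> ereal) \<Rightarrow> real measure \<Rightarrow> bool" where
  "conv_in_distr M T L \<longleftrightarrow>
     weak_conv (\<lambda>n t. measure M {\<omega> \<in> space M. T n \<omega> \<le> ereal t}) (cdf L)"

lemma el_ratio_attained:
  assumes "el_feasible n v \<noteq> {}"
  shows "\<exists>p \<in> el_feasible n v. (\<Prod>i = 1..n. real n * p i) = el_ratio n v
           \<and> (\<forall>q \<in> el_feasible n v. (\<Prod>i = 1..n. real n * q i) \<le> el_ratio n v)"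
proof -
  define Q where "Q p = (\<Prod>i = 1..n. real n * p i)" for p :: "nat \<Rightarrow> real"
  define B where "B = (PiE UNIV (\<lambda>i. if i \<in> {1..n} then {0..1} else {0}) :: (nat \<Rightarrow> real) set)"
  define S where "S = B \<inter> ({p. (\<Sum>i = 1..n. p i) = 1} \<inter> {p. (\<Sum>i = 1..n. p i * v i) = 0})"
  have "compactin (product_topology (\<lambda>i::nat. euclidean :: real topology) UNIV) B"
    unfolding B_def by (subst compactin_PiE) auto
  then have "compact B"
    by (simp add: euclidean_product_topology)
  moreover have c: "continuous_on UNIV (\<lambda>p::nat \<Rightarrow> real. p i)" for i
    by (rule continuous_on_product_coordinates)
  have "closed {p::nat \<Rightarrow> real. (\<Sum>i = 1..n. p i) = 1}"
    by (intro closed_Collect_eq continuous_intros c)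
  moreover have "closed {p::nat \<Rightarrow> real. (\<Sum>i = 1..n. p i * v i) = 0}"
    by (intro closed_Collect_eq continuous_intros c)
  ultimately have S_compact: "compact S"
    unfolding S_def by (intro compact_Int_closed closed_Int)
  have S_feas: "S \<subseteq> el_feasible n v"
    unfolding S_def B_def el_feasible_def by (auto simp: PiE_iff split: if_splits)
  have feas_S: "\<exists>q \<in> S. Q q = Q p" if "p \<in> el_feasible n v" for p
  proof -
    let ?q = "\<lambda>i. if i \<in> {1..n} then p i else 0"
    have "p i \<le> 1" if "i \<in> {1..n}" for i
      using member_le_sum[OF that, of p] \<open>p \<in> el_feasible n v\<close> by (auto simp: el_feasible_def)
    then have "?q \<in> B"
      using that by (auto simp: B_def el_feasible_def PiE_iff)
    moreover have "(\<Sum>i = 1..n. ?q i) = (\<Sum>i = 1..n. p i)"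
      "(\<Sum>i = 1..n. ?q i * v i) = (\<Sum>i = 1..n. p i * v i)"
      by (auto intro!: sum.cong)
    moreover have "Q ?q = Q p"
      unfolding Q_def by (auto intro!: prod.cong)
    ultimately show ?thesis
      using that by (intro bexI[of _ ?q]) (auto simp: S_def el_feasible_def)
  qed
  have "continuous_on S Q"
    unfolding Q_def
    by (intro continuous_intros continuous_on_subset[OF c]) auto
  moreover have "S \<noteq> {}"
    using assms feas_S by blast
  ultimately obtain p where p: "p \<in> S" "\<And>q. q \<in> S \<Longrightarrow> Q q \<le> Q p"
    using continuous_attains_sup[OF S_compact] by blast
  have max: "Q q \<le> Q p" if "q \<in> el_feasible n v" for q
    using feas_S[OF that] p(2) by metis
  have "(SUP q \<in> el_feasible n v. Q q) = Q p"
    using max p(1) S_feas by (intro cSup_eq_maximum) auto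
  then have "el_ratio n v = Q p"
    using assms by (simp add: el_ratio_def Q_def)
  then show ?thesis
    using max p(1) S_feas unfolding Q_def by (intro bexI[of _ p]) auto
qed

end

theory Submission
  imports Defs
begin

text \<open>Let \<open>g x\<close> be the expectation of the kernel with one argument fixed at \<open>x\<close>. Under symmetry it
  has mean zero, and the remainder \<open>h - g - g - g\<close> of the kernel is completely degenerate at first
  order: two of its values on triples sharing at most one index are uncorrelated. Counting overlapping
  triples, the \<open>i\<close>-th pseudo-value is \<open>3 g (X\<^sub>i)\<close> up to an error of mean square \<open>O(1/n)\<close>, and the
  mean of the pseudo-values is the mean of the \<open>3 g (X\<^sub>i)\<close> up to a mean square error \<open>O(1/n\<^sup>2)\<close>.
  So the mean is asymptotically normal and the mean of squares converges to the variance of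
  \<open>3 g (X)\<close>. That variance is positive because \<open>g' = 1/6 - F (1 - F)\<close>
  is negative where \<open>F\<close> is near \<open>1/2\<close>.

  If \<open>V\<close>, \<open>S\<close> and \<open>b\<close> are the mean, the mean square and the largest modulus of the pseudo-values and
  \<open>\<bar>V\<bar> b\<close> is small against \<open>S\<close>, then \<open>-2 log R\<close> is \<open>n V\<^sup>2 / S\<close> up to a factor close to \<open>1\<close>: weak
  duality with the multiplier \<open>V / S\<close> bounds it from below and the weights of the Euclidean
  likelihood bound it from above, so the Lagrange equation never has to be solved.\<close>

subsection \<open>Empirical likelihood\<close>

text \<open>The kernel is the midrange of its three arguments minus their mean, so it is odd under
  reflection; this is how symmetry centres the projection. Degeneracy of the remainder is
  indispensable: pairs of triples sharing a single index number about \<open>n^5\<close>, and after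
  division by \<open>n^6\<close> they would contribute to the mean at the order \<open>1/n\<close>
  of the leading term. Pairs sharing two or more indices number only about \<open>n^4\<close>. All
  approximations are deterministic on one event governed by a single small number \<open>d\<close>.
  Its five conditions are controlled with second moments only; in particular the largest
  pseudo-value is of smaller order than \<open>sqrt n\<close> because the largest projected value
  is, and each error is bounded through the sum of all squared errors. The limit is taken in
  \<open>n\<close> for fixed \<open>d\<close>, and then in \<open>d\<close>, so no convergence
  theorem for extended-real variables is needed. A separate obstacle is measurability: the ratio is
  a supremum over a set of weights that depends on the data, and \<open>measure\<close> gives 0 to
  nonmeasurable sets. Closedness of the superlevel sets of the ratio settles this.\<close>

lemma ln_one_plus_ge_quadratic:
  fixes x d :: real
  assumes d: "0 \<le> d" "d < 1" and x: "- d \<le> x"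
  shows "x - x\<^sup>2 / (2 * (1 - d)) \<le> ln (1 + x)"
proof -
  define \<phi> where "\<phi> y = ln (1 + y) - y + y\<^sup>2 / (2 * (1 - d))" for y
  \<comment> \<open>Since \<open>1 + y\<close> is at least \<open>1 - d\<close>, this derivative has
    the sign of \<open>y\<close>; hence \<open>\<phi>\<close> attains its minimum, 0, at 0.\<close>
  have der: "(\<phi> has_real_derivative y * (1 / (1 - d) - 1 / (1 + y))) (at y)" if "- d \<le> y" for y
  proof -
    have y: "0 < 1 + y"
      using d that by simp
    then have "(\<phi> has_real_derivative 1 / (1 + y) - 1 + 2 * y / (2 * (1 - d))) (at y)"
      unfolding \<phi>_def using d by (auto intro!: derivative_eq_intros)
    moreover have "1 / (1 + y) - 1 = - (y / (1 + y))"
      using y by (simp add: field_simps)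
    moreover have "2 * y / (2 * (1 - d)) = y / (1 - d)"
      by (rule mult_divide_mult_cancel_left) simp
    ultimately show ?thesis
      by (simp add: right_diff_distrib)
  qed
  have "\<phi> 0 \<le> \<phi> x"
  proof (cases "0 \<le> x")
    case True
    have "0 \<le> y * (1 / (1 - d) - 1 / (1 + y))" if "0 \<le> y" for y
      using d that frac_le[of 1 1 "1 - d" "1 + y"] by (intro mult_nonneg_nonneg) auto
    then show ?thesis
      using der d True
      by (intro DERIV_nonneg_imp_nondecreasing[of 0 x \<phi>]) (meson neg_le_0_iff_le order_trans)+
  next
    case False
    have "y * (1 / (1 - d) - 1 / (1 + y)) \<le> 0" if "- d \<le> y" "y \<le> 0" for y
      using d that frac_le[of 1 1 "1 - d" "1 + y"] by (intro mult_nonpos_nonneg) auto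
    then show ?thesis
      using der x False
      by (intro DERIV_nonpos_imp_nonincreasing[of x 0 \<phi>]) (meson nle_le order_trans)+
  qed
  then show ?thesis
    by (simp add: \<phi>_def)
qed

lemma el_ratio_nonneg: "0 \<le> el_ratio n v"
proof (cases "el_feasible n v = {}")
  case False
  then obtain p where "p \<in> el_feasible n v" "(\<Prod>i = 1..n. real n * p i) = el_ratio n v"
    using el_ratio_attained by blast
  moreover from this have "0 \<le> (\<Prod>i = 1..n. real n * p i)"
    by (intro prod_nonneg) (auto simp: el_feasible_def)
  ultimately show ?thesis by simp
qed (simp add: el_ratio_def)

lemma el_ratio_ge: "p \<in> el_feasible n v \<Longrightarrow> (\<Prod>i = 1..n. real n * p i) \<le> el_ratio n v"
  using el_ratio_attained by blast

text \<open>Weak duality, with \<open>l\<close> the Lagrange multiplier of the moment constraint.\<close>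

lemma el_ratio_dual:
  assumes pos: "\<And>i. i \<in> {1..n} \<Longrightarrow> 0 \<le> 1 + l * v i"
  shows "el_ratio n v * (\<Prod>i = 1..n. 1 + l * v i) \<le> 1"
proof (cases "el_feasible n v = {}")
  case False
  then obtain p where p: "p \<in> el_feasible n v" "(\<Prod>i = 1..n. real n * p i) = el_ratio n v"
    using el_ratio_attained by blast
  have "(\<Prod>i = 1..n. real n * p i) * (\<Prod>i = 1..n. 1 + l * v i)
      = (\<Prod>i = 1..n. real n * p i * (1 + l * v i))"
    by (simp add: prod.distrib)
  \<comment> \<open>The inequality \<open>u \<le> exp (u - 1)\<close> with equality at 1; by
    feasibility the exponents add up to \<open>n * 1 + n * l * 0 - n\<close>, which is 0.\<close>
  also have "\<dots> \<le> (\<Prod>i = 1..n. exp (real n * p i * (1 + l * v i) - 1))"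
  proof (intro prod_mono conjI)
    show "real n * p i * (1 + l * v i) \<le> exp (real n * p i * (1 + l * v i) - 1)" for i
      using exp_ge_add_one_self[of "real n * p i * (1 + l * v i) - 1"] by simp
  qed (use p pos in \<open>auto simp: el_feasible_def\<close>)
  also have "\<dots> = exp (\<Sum>i = 1..n. real n * p i * (1 + l * v i) - 1)"
    by (simp add: exp_sum)
  also have "(\<Sum>i = 1..n. real n * p i * (1 + l * v i) - 1)
      = real n * (\<Sum>i = 1..n. p i) + real n * l * (\<Sum>i = 1..n. p i * v i) - real n"
    by (simp add: sum_subtractf sum.distrib sum_distrib_left algebra_simps)
  also have "\<dots> = 0"
    using p by (simp add: el_feasible_def)
  finally show ?thesis
    using p by simp
qed (simp add: el_ratio_def)

lemma el_ratio_le_1: "el_ratio n v \<le> 1"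
  using el_ratio_dual[of n 0 v] by simp

lemma neg2_log_le_iff:
  assumes "0 \<le> r"
  shows "neg2_log r \<le> ereal t \<longleftrightarrow> exp (- t / 2) \<le> r"
proof (cases "r = 0")
  case False
  then have "r > 0" using assms by simp
  then have "exp (- t / 2) \<le> r \<longleftrightarrow> - t / 2 \<le> ln r"
    by (simp add: ln_ge_iff)
  then show ?thesis
    using False by (auto simp: neg2_log_def)
qed (auto simp: neg2_log_def not_le)

lemma neg2_log_ge:
  assumes "0 \<le> r" "r \<le> exp (- t / 2)"
  shows "ereal t \<le> neg2_log r"
proof (cases "r = 0")
  case False
  then have "ln r \<le> ln (exp (- t / 2))"
    using assms by (subst ln_le_cancel_iff) auto
  then show ?thesis
    using False by (simp add: neg2_log_def)
qed (simp add: neg2_log_def)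

text \<open>The multiplier \<open>V / S\<close> maximises the quadratic approximation
  \<open>l * n * V - l^2 * n * S / 2\<close> of the logarithm of the dual product, and the maximum
  is half of \<open>n * V^2 / S\<close>. The hypothesis \<open>small\<close> makes every
  \<open>V / S * v i\<close> at most \<open>e\<close> in modulus, so replacing the logarithm by a
  quadratic costs only factors such as \<open>1 / (1 - e)\<close>; all of them are absorbed in
  \<open>1 - 10 * e\<close> and \<open>1 + 10 * e\<close>.\<close>

lemma neg2_log_el_ratio_bounds:
  fixes v :: "nat \<Rightarrow> real"
  assumes n: "n \<ge> 1" and V: "V = (\<Sum>i = 1..n. v i) / n" and S: "S = (\<Sum>i = 1..n. (v i)\<^sup>2) / n"
    and S_pos: "S > 0" and b: "\<And>i. i \<in> {1..n} \<Longrightarrow> \<bar>v i\<bar> \<le> b"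
    and small: "\<bar>V\<bar> * b \<le> e * S" and e: "e \<le> 1 / 10"
  shows "ereal ((1 - 10 * e) * (real n * V\<^sup>2 / S)) \<le> neg2_log (el_ratio n v)"
    and "neg2_log (el_ratio n v) \<le> ereal ((1 + 10 * e) * (real n * V\<^sup>2 / S))"
proof -
  define W where "W = real n * V\<^sup>2 / S"
  have W_nonneg: "0 \<le> W"
    using S_pos by (simp add: W_def)
  have sum_v: "(\<Sum>i = 1..n. v i) = n * V" and sum_v2: "(\<Sum>i = 1..n. (v i)\<^sup>2) = n * S"
    using n by (simp_all add: V S)
  have b_nonneg: "0 \<le> b"
    using b[of 1] n by auto
  then have "0 \<le> e * S"
    using small by (meson abs_ge_zero mult_nonneg_nonneg order_trans)
  then have e_nonneg: "0 \<le> e"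
    using S_pos by (simp add: zero_le_mult_iff)
  have "\<bar>V\<bar> \<le> b"
  proof -
    have "\<bar>V\<bar> \<le> (\<Sum>i = 1..n. \<bar>v i\<bar>) / n"
      unfolding V by (simp add: abs_divide divide_right_mono)
    also have "\<dots> \<le> (\<Sum>i = 1..n. b) / n"
      by (intro divide_right_mono sum_mono b) auto
    finally show ?thesis
      using n by simp
  qed
  \<comment> \<open>The squared mean is a small fraction of the mean square, so the variance
    \<open>S - V\<^sup>2\<close> is comparable with \<open>S\<close>.\<close>
  then have V2: "V\<^sup>2 \<le> e * S"
    using small mult_left_mono[of "\<bar>V\<bar>" b "\<bar>V\<bar>"] by (simp add: power2_eq_square abs_mult_self_eq)

  have le: "\<bar>V / S * v i\<bar> \<le> e" if "i \<in> {1..n}" for i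
  proof -
    have "\<bar>V / S * v i\<bar> \<le> \<bar>V\<bar> * b / S"
      using b[OF that] S_pos by (simp add: abs_mult divide_right_mono mult_left_mono)
    also have "\<dots> \<le> e"
      using small S_pos by (simp add: field_simps)
    finally show ?thesis .
  qed
  have pos: "0 < 1 + V / S * v i" if "i \<in> {1..n}" for i
    using abs_le_D2[OF le[OF that]] e by linarith
  have "(1 - 10 * e) * W / 2 \<le> W - W / (2 * (1 - e))"
  proof -
    have "1 / (1 - e) \<le> 1 + 10 * e"
    proof -
      have "10 * e * e \<le> e"
        using e e_nonneg mult_right_mono[of "10 * e" 1 e] by simp
      then have "1 \<le> (1 + 10 * e) * (1 - e)"
        using e_nonneg by (simp add: algebra_simps)
      then show ?thesis
        using e by (simp add: pos_divide_le_eq)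
    qed
    then have "W * (1 / (1 - e)) \<le> W * (1 + 10 * e)"
      using W_nonneg by (rule mult_left_mono)
    then have "W - W * (1 + 10 * e) / 2 \<le> W - W * (1 / (1 - e)) / 2"
      by (intro diff_left_mono divide_right_mono) auto
    then show ?thesis
      by (simp add: field_simps)
  qed
  also have "W - W / (2 * (1 - e))
      = V / S * (\<Sum>i = 1..n. v i) - (V / S)\<^sup>2 * (\<Sum>i = 1..n. (v i)\<^sup>2) / (2 * (1 - e))"
    using S_pos unfolding sum_v sum_v2 W_def by (simp add: field_simps power2_eq_square)
  also have "\<dots> = (\<Sum>i = 1..n. V / S * v i - (V / S * v i)\<^sup>2 / (2 * (1 - e)))"
    by (simp only: sum_subtractf sum_distrib_left sum_divide_distrib power_mult_distrib)
  also have "\<dots> \<le> (\<Sum>i = 1..n. ln (1 + V / S * v i))"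
  proof (intro sum_mono ln_one_plus_ge_quadratic)
    show "- e \<le> V / S * v i" if "i \<in> {1..n}" for i
      using abs_le_D2[OF le[OF that]] by linarith
  qed (use e e_nonneg in auto)
  also have "\<dots> = ln (\<Prod>i = 1..n. 1 + V / S * v i)"
    using pos by (subst ln_prod) force+
  finally have "exp ((1 - 10 * e) * W / 2) \<le> (\<Prod>i = 1..n. 1 + V / S * v i)"
    using pos by (subst (asm) ln_ge_iff) (auto intro!: prod_pos)
  then have "el_ratio n v * exp ((1 - 10 * e) * W / 2) \<le> el_ratio n v * (\<Prod>i = 1..n. 1 + V / S * v i)"
    by (rule mult_left_mono[OF _ el_ratio_nonneg])
  also have "\<dots> \<le> 1"
    by (rule el_ratio_dual) (use pos in \<open>simp add: less_imp_le\<close>)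
  finally have "el_ratio n v \<le> 1 / exp ((1 - 10 * e) * W / 2)"
    by (subst pos_le_divide_eq) auto
  also have "\<dots> = exp (- ((1 - 10 * e) * W) / 2)"
    by (simp only: exp_minus inverse_eq_divide minus_divide_left[symmetric])
  finally show "ereal ((1 - 10 * e) * (real n * V\<^sup>2 / S)) \<le> neg2_log (el_ratio n v)"
    unfolding W_def[symmetric] by (intro neg2_log_ge el_ratio_nonneg)

  \<comment> \<open>Euclidean likelihood minimises the sum of squares of \<open>n * p i - 1\<close>
    under the two linear constraints. Its weights are affine in \<open>v i\<close>, and the moment
    constraint \<open>V - a * (S - V\<^sup>2) = 0\<close> determines the slope.\<close>
  define a where "a = V / (S - V\<^sup>2)"
  have eS: "e * S \<le> 1 / 10 * S"
    using e S_pos by (intro mult_right_mono) auto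
  have SV: "(1 - e) * S \<le> S - V\<^sup>2"
    using V2 by (simp add: algebra_simps)
  have SV_pos: "0 < S - V\<^sup>2"
    using V2 eS S_pos by linarith
  \<comment> \<open>A factor 2 comes from \<open>\<bar>v i - V\<bar> \<le> 2 * b\<close>, another
    from \<open>S \<le> 2 * (S - V\<^sup>2)\<close>. As \<open>4 * e\<close> is below 1, the weights
    are positive.\<close>
  have le4: "\<bar>a * (v i - V)\<bar> \<le> 4 * e" if "i \<in> {1..n}" for i
  proof -
    have "\<bar>v i - V\<bar> \<le> 2 * b"
      using b[OF that] \<open>\<bar>V\<bar> \<le> b\<close> by linarith
    then have "\<bar>V\<bar> * \<bar>v i - V\<bar> \<le> \<bar>V\<bar> * (2 * b)"
      by (intro mult_left_mono) auto
    also have "\<dots> \<le> 2 * (e * S)"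
      using small by simp
    also have "\<dots> \<le> 4 * e * (S - V\<^sup>2)"
    proof -
      have "V\<^sup>2 \<le> 1 / 10 * S"
        using V2 eS by (rule order_trans)
      then have "S \<le> 2 * (S - V\<^sup>2)"
        using S_pos by simp
      then show ?thesis
        using mult_left_mono[OF _ e_nonneg, of S "2 * (S - V\<^sup>2)"] by (simp add: algebra_simps)
    qed
    finally show ?thesis
      using SV_pos by (simp add: a_def abs_mult abs_divide pos_divide_le_eq)
  qed
  have pos4: "0 < 1 - a * (v i - V)" if "i \<in> {1..n}" for i
    using abs_le_D1[OF le4[OF that]] e by linarith
  have var: "(\<Sum>i = 1..n. (v i - V)\<^sup>2) = n * (S - V\<^sup>2)"
  proof -
    have "(\<Sum>i = 1..n. (v i - V)\<^sup>2) = (\<Sum>i = 1..n. (v i)\<^sup>2) + n * V\<^sup>2 - 2 * V * (\<Sum>i = 1..n. v i)"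
      by (simp add: power2_diff sum.distrib sum_subtractf sum_distrib_left algebra_simps)
    then show ?thesis
      unfolding sum_v sum_v2 by (simp add: algebra_simps power2_eq_square)
  qed
  have cen: "(\<Sum>i = 1..n. v i - V) = 0"
    by (simp only: sum_subtractf sum_v) simp
  define p where "p i = (1 - a * (v i - V)) / n" for i
  have sum_p: "(\<Sum>i = 1..n. p i) = 1"
  proof -
    have "(\<Sum>i = 1..n. 1 - a * (v i - V)) = n - a * (\<Sum>i = 1..n. v i - V)"
      unfolding sum_subtractf[of "\<lambda>_. 1"] sum_distrib_left by simp
    then have "(\<Sum>i = 1..n. p i) = (n - a * (\<Sum>i = 1..n. v i - V)) / n"
      unfolding p_def by (simp only: sum_divide_distrib[symmetric])
    then show ?thesis
      using n cen by simp
  qed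
  have "(\<Sum>i = 1..n. p i * v i) = 0"
  proof -
    have "p i * v i = (v i - a * (v i - V)\<^sup>2 - a * V * (v i - V)) / n" for i
      by (simp add: p_def power2_eq_square algebra_simps)
    moreover have "(\<Sum>i = 1..n. v i - a * (d i)\<^sup>2 - a * V * d i)
        = (\<Sum>i = 1..n. v i) - a * (\<Sum>i = 1..n. (d i)\<^sup>2) - a * V * (\<Sum>i = 1..n. d i)" for d
      by (simp only: sum_subtractf sum_distrib_left)
    ultimately have "(\<Sum>i = 1..n. p i * v i)
        = ((\<Sum>i = 1..n. v i) - a * (\<Sum>i = 1..n. (v i - V)\<^sup>2) - a * V * (\<Sum>i = 1..n. v i - V)) / n"
      by (simp only: sum_divide_distrib[symmetric])
    then show ?thesis
      using SV_pos n unfolding cen var sum_v by (simp add: a_def)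
  qed
  with sum_p pos4 have p: "p \<in> el_feasible n v"
    unfolding el_feasible_def p_def by (auto simp: less_imp_le)
  have "- ((1 + 10 * e) * W) / 2 \<le> - (a\<^sup>2 * (n * (S - V\<^sup>2)) / (2 * (1 - 4 * e)))"
  proof -
    have "a\<^sup>2 * (n * (S - V\<^sup>2)) = n * V\<^sup>2 / (S - V\<^sup>2)"
      using SV_pos by (simp add: a_def power2_eq_square)
    also have "\<dots> \<le> n * V\<^sup>2 / ((1 - e) * S)"
      using SV SV_pos e S_pos by (intro divide_left_mono) auto
    also have "\<dots> = W / (1 - e)"
      by (simp add: W_def)
    finally have "a\<^sup>2 * (n * (S - V\<^sup>2)) / (1 - 4 * e) \<le> W / (1 - e) / (1 - 4 * e)"
      using e by (intro divide_right_mono) auto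
    also have "\<dots> = W * (1 / ((1 - e) * (1 - 4 * e)))"
      by simp
    also have "\<dots> \<le> W * (1 + 10 * e)"
    proof (intro mult_left_mono W_nonneg)
      \<comment> \<open>The source of the constant 10 and of the bound \<open>1 / 10\<close> on
        \<open>e\<close>: the product is \<open>1 + 5 * e - 50 * e^2\<close>, which is at least 1
        exactly when \<open>e\<close> lies between 0 and \<open>1 / 10\<close>.\<close>
      have "1 \<le> (1 + 10 * e) * (1 - 5 * e)"
      proof -
        have "50 * e * e \<le> 5 * e"
          using e e_nonneg mult_right_mono[of "50 * e" 5 e] by simp
        then show ?thesis
          by (simp add: algebra_simps)
      qed
      also have "\<dots> \<le> (1 + 10 * e) * ((1 - e) * (1 - 4 * e))"
        using e_nonneg by (intro mult_left_mono) (auto simp: algebra_simps)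
      finally show "1 / ((1 - e) * (1 - 4 * e)) \<le> 1 + 10 * e"
        using e by (simp add: pos_divide_le_eq)
    qed
    finally have "a\<^sup>2 * (n * (S - V\<^sup>2)) / (1 - 4 * e) / 2 \<le> W * (1 + 10 * e) / 2"
      by (rule divide_right_mono) simp
    then show ?thesis
      by (simp only: divide_divide_eq_left minus_divide_left[symmetric] neg_le_iff_le mult.commute)
  qed
  \<comment> \<open>The linear term is zero by \<open>cen\<close>; it is inserted so that the
    quadratic bound for the logarithm can be applied to each summand.\<close>
  also have "\<dots> = - a * (\<Sum>i = 1..n. v i - V) - a\<^sup>2 * (\<Sum>i = 1..n. (v i - V)\<^sup>2) / (2 * (1 - 4 * e))"
    unfolding var cen by simp
  also have "\<dots> = (\<Sum>i = 1..n. - a * (v i - V) - (- a * (v i - V))\<^sup>2 / (2 * (1 - 4 * e)))"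
  proof -
    have "- a * (\<Sum>i = 1..n. d i) - a\<^sup>2 * (\<Sum>i = 1..n. (d i)\<^sup>2) / c
        = (\<Sum>i = 1..n. - a * d i - (- a * d i)\<^sup>2 / c)" for c and d :: "nat \<Rightarrow> real"
      by (simp only: sum_subtractf sum_distrib_left sum_divide_distrib power_mult_distrib power2_minus)
    then show ?thesis .
  qed
  also have "\<dots> \<le> (\<Sum>i = 1..n. ln (1 + - a * (v i - V)))"
  proof (intro sum_mono ln_one_plus_ge_quadratic)
    show "- (4 * e) \<le> - a * (v i - V)" if "i \<in> {1..n}" for i
      using abs_le_D1[OF le4[OF that]] by (simp only: mult_minus_left neg_le_iff_le)
  qed (use e e_nonneg in auto)
  also have "\<dots> = ln (\<Prod>i = 1..n. 1 - a * (v i - V))"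
    using pos4 by (subst ln_prod) force+
  finally have "exp (- ((1 + 10 * e) * W) / 2) \<le> (\<Prod>i = 1..n. 1 - a * (v i - V))"
    using pos4 by (subst (asm) ln_ge_iff) (auto intro!: prod_pos)
  also have "\<dots> = (\<Prod>i = 1..n. real n * p i)"
    using n by (simp add: p_def)
  also have "\<dots> \<le> el_ratio n v"
    by (rule el_ratio_ge[OF p])
  finally show "neg2_log (el_ratio n v) \<le> ereal ((1 + 10 * e) * (real n * V\<^sup>2 / S))"
    unfolding W_def[symmetric] by (subst neg2_log_le_iff) (auto simp: el_ratio_nonneg)
qed

section \<open>Measurability of the likelihood ratio\<close>

lemma closed_projection_compact:
  fixes B :: "'a::topological_space set" and T :: "('b::topological_space \<times> 'a) set"
  assumes B: "compact B" and T: "closed T"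
  shows "closed {y. \<exists>x \<in> B. (y, x) \<in> T}"
proof -
  have "closed_map (prod_topology (euclidean :: 'b topology) (top_of_set B)) euclidean fst"
    using B by (intro Abstract_Topological_Spaces.closed_map_fst compact_space_subtopology) simp
  moreover have "prod_topology (euclidean :: 'b topology) (top_of_set B) = top_of_set (UNIV \<times> B)"
    using prod_topology_subtopology_eu[of UNIV B] by simp
  moreover have "closedin (top_of_set (UNIV \<times> B)) ((UNIV \<times> B) \<inter> T)"
    using T by (rule closedin_closed_Int)
  ultimately have "closed (fst ` ((UNIV \<times> B) \<inter> T))"
    unfolding closed_closedin closed_map_def by metis
  moreover have "fst ` ((UNIV \<times> B) \<inter> T) = {y. \<exists>x \<in> B. (y, x) \<in> T}"
    by force
  ultimately show ?thesis
    by simp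
qed

text \<open>Because the maximum is attained, the superlevel set is the projection of a closed set of
  pairs of values and weights along a compact box of weights, and such projections are closed (tube
  lemma). At a positive level the values without feasible weights, where the ratio is 0 by
  convention, are outside.\<close>

lemma closed_el_ratio_ge:
  assumes "0 < c"
  shows "closed {v. c \<le> el_ratio n v}"
proof -
  \<comment> \<open>Weights are set to 0 off the index range, which makes the box compact in the
    product over all naturals. Any feasible vector can be cut down to this form without changing its
    sums and its product.\<close>
  define B where "B = (PiE UNIV (\<lambda>i. if i \<in> {1..n} then {0..1} else {0}) :: (nat \<Rightarrow> real) set)"
  define T where "T = {z :: (nat \<Rightarrow> real) \<times> (nat \<Rightarrow> real). (\<Sum>i = 1..n. snd z i) = 1}
      \<inter> {z. (\<Sum>i = 1..n. snd z i * fst z i) = 0} \<inter> {z. c \<le> (\<Prod>i = 1..n. real n * snd z i)}"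
  have "compactin (product_topology (\<lambda>i::nat. euclidean :: real topology) UNIV) B"
    unfolding B_def by (subst compactin_PiE) auto
  then have "compact B"
    by (simp add: euclidean_product_topology)
  moreover have "closed T"
    unfolding T_def
    by (intro closed_Int closed_Collect_eq closed_Collect_le continuous_intros
        continuous_on_product_then_coordinatewise)
  ultimately have "closed {v. \<exists>p \<in> B. (v, p) \<in> T}"
    by (rule closed_projection_compact)
  moreover have "(\<exists>p \<in> B. (v, p) \<in> T) \<longleftrightarrow> c \<le> el_ratio n v" for v
  proof
    assume "\<exists>p \<in> B. (v, p) \<in> T"
    then obtain p where "p \<in> B" "(v, p) \<in> T" by blast
    then have "p \<in> el_feasible n v" "c \<le> (\<Prod>i = 1..n. real n * p i)"
      by (auto simp: B_def T_def el_feasible_def PiE_iff split: if_splits)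
    then show "c \<le> el_ratio n v"
      using el_ratio_ge by (meson order_trans)
  next
    assume c: "c \<le> el_ratio n v"
    then have "el_feasible n v \<noteq> {}"
      using assms by (auto simp: el_ratio_def)
    then obtain p where p: "p \<in> el_feasible n v" "(\<Prod>i = 1..n. real n * p i) = el_ratio n v"
      using el_ratio_attained by blast
    let ?q = "\<lambda>i. if i \<in> {1..n} then p i else 0"
    have "p i \<le> 1" if "i \<in> {1..n}" for i
      using member_le_sum[OF that, of p] p(1) by (auto simp: el_feasible_def)
    then have "?q \<in> B"
      using p by (auto simp: B_def el_feasible_def PiE_iff)
    moreover have "(\<Sum>i = 1..n. ?q i) = (\<Sum>i = 1..n. p i)"
      "(\<Sum>i = 1..n. ?q i * v i) = (\<Sum>i = 1..n. p i * v i)"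
      "(\<Prod>i = 1..n. real n * ?q i) = (\<Prod>i = 1..n. real n * p i)"
      by (auto intro!: sum.cong prod.cong)
    then have "(v, ?q) \<in> T"
      using p c unfolding T_def el_feasible_def by simp
    ultimately show "\<exists>p \<in> B. (v, p) \<in> T"
      by blast
  qed
  ultimately show ?thesis
    by simp
qed

lemma sets_neg2_log_el_ratio_le:
  assumes "\<And>i. (\<lambda>\<omega>. v \<omega> i) \<in> borel_measurable M"
  shows "{\<omega> \<in> space M. neg2_log (el_ratio n (v \<omega>)) \<le> ereal t} \<in> sets M"
proof -
  have v: "v \<in> borel_measurable M"
    using assms by (rule measurable_coordinatewise_then_product)
  have "{w. exp (- t / 2) \<le> el_ratio n w} \<in> sets borel"
    by (intro borel_closed closed_el_ratio_ge) simp
  from measurable_sets[OF v this] have "v -` {w. exp (- t / 2) \<le> el_ratio n w} \<inter> space M \<in> sets M" .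
  also have "v -` {w. exp (- t / 2) \<le> el_ratio n w} \<inter> space M
      = {\<omega> \<in> space M. neg2_log (el_ratio n (v \<omega>)) \<le> ereal t}"
    by (auto simp only: neg2_log_le_iff[OF el_ratio_nonneg])
  finally show ?thesis .
qed

subsection \<open>Jackknife pseudo-values\<close>

definition triples :: "nat set \<Rightarrow> (nat \<times> nat \<times> nat) set" where
  "triples A = {(i, j, k). i \<in> A \<and> j \<in> A \<and> k \<in> A \<and> k < j \<and> j < i}"

definition indices :: "nat \<times> nat \<times> nat \<Rightarrow> nat set" where
  "indices = (\<lambda>(i, j, k). {i, j, k})"

definition kern_at :: "(nat \<Rightarrow> real) \<Rightarrow> nat \<times> nat \<times> nat \<Rightarrow> real" where
  "kern_at x = (\<lambda>(i, j, k). kern (x i) (x j) (x k))"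

text \<open>Degeneracy makes the residuals of two triples uncorrelated as soon as at most one index
  is shared; this relation marks the pairs that remain.\<close>

definition overlap :: "nat \<times> nat \<times> nat \<Rightarrow> nat \<times> nat \<times> nat \<Rightarrow> bool" where
  "overlap t t' \<longleftrightarrow> (\<exists>p q. p \<noteq> q \<and> {p, q} \<subseteq> indices t \<inter> indices t')"

lemma finite_triples: "finite A \<Longrightarrow> finite (triples A)"
  by (rule finite_subset[of _ "A \<times> A \<times> A"]) (auto simp: triples_def)

lemma indices_subset: "t \<in> triples A \<Longrightarrow> indices t \<subseteq> A"
  by (auto simp: triples_def indices_def)

lemma card_indices: "t \<in> triples A \<Longrightarrow> card (indices t) = 3"
  by (auto simp: triples_def indices_def)

text \<open>A decreasing triple is recovered from its index set as the largest, the remaining and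
  the smallest element. This turns counting triples into counting 3-subsets.\<close>

lemma bij_betw_indices: "bij_betw indices (triples A) {T. T \<subseteq> A \<and> card T = 3}"
proof -
  have "inj_on indices (triples A)"
  proof (rule inj_onI)
    fix s t assume st: "s \<in> triples A" "t \<in> triples A" "indices s = indices t"
    have M: "fst t = Max (indices t) \<and> snd (snd t) = Min (indices t)
        \<and> {fst (snd t)} = indices t - {fst t, snd (snd t)}" if "t \<in> triples A" for t
      using that by (auto simp: triples_def indices_def)
    have "{fst (snd s)} = {fst (snd t)}"
      using M[OF st(1)] M[OF st(2)] st(3) by metis
    then have "fst (snd s) = fst (snd t)"
      by simp
    then show "s = t"
      using M[OF st(1)] M[OF st(2)] st(3) by (simp add: prod_eq_iff)
  qed
  moreover have "T \<in> indices ` triples A" if T: "T \<subseteq> A" "card T = 3" for T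
  proof -
    obtain a b c where abc: "T = {a, b, c}" "a \<noteq> b" "a \<noteq> c" "b \<noteq> c"
      using T(2) by (auto simp: card_3_iff)
    have *: "T \<in> indices ` triples A" if "T = {i, j, k}" "k < j" "j < i" for i j k
      using that T(1) by (intro image_eqI[of _ _ "(i, j, k)"]) (auto simp: indices_def triples_def)
    consider "c < b" "b < a" | "b < c" "c < a" | "c < a" "a < b" | "a < c" "c < b" | "a < b" "b < c" | "b < a" "a < c"
      using abc by linarith
    then show ?thesis
      using abc(1) by cases (metis * insert_commute)+
  qed
  ultimately show ?thesis
    using card_indices[of _ A] indices_subset[of _ A] unfolding bij_betw_def by blast
qed

lemma card_triples: "finite A \<Longrightarrow> card (triples A) = card A choose 3"
  using bij_betw_same_card[OF bij_betw_indices] by (simp add: n_subsets)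

lemma triples_Diff: "triples (A - {i}) = {t \<in> triples A. i \<notin> indices t}"
  by (auto simp: triples_def indices_def)

text \<open>Stated with real subtraction, so that it covers \<open>n < 3\<close>, where both sides
  vanish, and can be subtracted for neighbouring sample sizes.\<close>

lemma choose_three: "real (n choose 3) = real n * (real n - 1) * (real n - 2) / 6"
proof (cases n)
  case (Suc m)
  have "3 * (n choose 3) = n * (m choose 2)"
    using Suc_times_binomial[of 2 m] by (simp add: Suc numeral_3_eq_3)
  then have "3 * real (n choose 3) = n * real (m choose 2)"
    by (metis of_nat_mult of_nat_numeral)
  moreover have "real (m choose 2) = m * (real m - 1) / 2"
    by (cases m) (simp_all add: choose_two real_of_nat_div algebra_simps)
  ultimately show ?thesis
    by (simp add: Suc field_simps)
qed simp

text \<open>The triples avoiding \<open>i\<close> are those of \<open>A - {i}\<close>, so the count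
  is the difference of two binomial coefficients.\<close>

lemma card_triples_containing:
  assumes "finite A" "i \<in> A"
  shows "real (card {t \<in> triples A. i \<in> indices t}) = (real (card A) - 1) * (real (card A) - 2) / 2"
proof -
  define N where "N = card A"
  have N: "N \<ge> 1"
    using assms card_gt_0_iff[of A] unfolding N_def by (metis One_nat_def Suc_leI empty_iff)
  have "{t \<in> triples A. i \<in> indices t} \<union> triples (A - {i}) = triples A"
    by (auto simp: triples_Diff)
  moreover have "{t \<in> triples A. i \<in> indices t} \<inter> triples (A - {i}) = {}"
    by (auto simp: triples_Diff)
  ultimately have "card (triples A) = card {t \<in> triples A. i \<in> indices t} + card (triples (A - {i}))"
    using assms card_Un_disjoint[of "{t \<in> triples A. i \<in> indices t}" "triples (A - {i})"]
    by (simp add: finite_triples)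
  then have "real (N choose 3) = real (card {t \<in> triples A. i \<in> indices t}) + real ((N - 1) choose 3)"
    using assms by (simp add: card_triples N_def)
  then have "real (card {t \<in> triples A. i \<in> indices t}) = real (N choose 3) - real ((N - 1) choose 3)"
    by simp
  also have "\<dots> = real N * (real N - 1) * (real N - 2) / 6
      - (real N - 1) * (real N - 1 - 1) * (real N - 1 - 2) / 6"
    using N by (simp only: choose_three of_nat_diff of_nat_1)
  also have "\<dots> = (real N - 1) * (real N - 2) / 2"
    by (simp add: field_simps)
  finally show ?thesis
    by (simp add: N_def)
qed

lemma indices_eq: "t \<in> triples A \<Longrightarrow> {l \<in> A. l \<in> indices t} = indices t"
  using indices_subset[of t A] by auto

text \<open>Double counting: the value \<open>g l\<close> occurs once for every triple containing
  \<open>l\<close>.\<close>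

lemma sum_triples_indices:
  fixes g :: "nat \<Rightarrow> real"
  assumes A: "finite A"
  shows "(\<Sum>t \<in> triples A. \<Sum>l \<in> indices t. g l)
      = (real (card A) - 1) * (real (card A) - 2) / 2 * (\<Sum>l \<in> A. g l)"
proof -
  have "(\<Sum>t \<in> triples A. \<Sum>l \<in> indices t. g l) = (\<Sum>t \<in> triples A. \<Sum>l \<in> {l \<in> A. l \<in> indices t}. g l)"
    by (intro sum.cong refl) (simp add: indices_eq)
  also have "\<dots> = (\<Sum>l \<in> A. \<Sum>t \<in> {t \<in> triples A. l \<in> indices t}. g l)"
    by (rule sum.swap_restrict) (use A in \<open>auto simp: finite_triples\<close>)
  also have "\<dots> = (\<Sum>l \<in> A. (real (card A) - 1) * (real (card A) - 2) / 2 * g l)"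
    using A by (intro sum.cong refl) (simp add: card_triples_containing)
  finally show ?thesis
    by (simp add: sum_distrib_left)
qed

lemma sum_triples_containing:
  fixes r :: "nat \<times> nat \<times> nat \<Rightarrow> real"
  assumes A: "finite A"
  shows "(\<Sum>l \<in> A. \<Sum>t \<in> {t \<in> triples A. l \<in> indices t}. r t) = 3 * (\<Sum>t \<in> triples A. r t)"
proof -
  have "(\<Sum>l \<in> A. \<Sum>t \<in> {t \<in> triples A. l \<in> indices t}. r t)
      = (\<Sum>t \<in> triples A. \<Sum>l \<in> {l \<in> A. l \<in> indices t}. r t)"
    by (rule sum.swap_restrict[symmetric]) (use A in \<open>auto simp: finite_triples\<close>)
  also have "\<dots> = (\<Sum>t \<in> triples A. \<Sum>l \<in> indices t. r t)"
    by (intro sum.cong refl) (simp add: indices_eq)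
  also have "\<dots> = (\<Sum>t \<in> triples A. 3 * r t)"
    by (intro sum.cong refl) (simp add: card_indices)
  finally show ?thesis
    by (simp add: sum_distrib_left)
qed

text \<open>Hoeffding's decomposition as a purely algebraic identity in \<open>g\<close>. With
  \<open>g\<close> the projection of the kernel it yields the linearisation, with
  \<open>g = 0\<close> it rewrites the statistic as a sum over triples.\<close>

lemma U_stat_decomp:
  fixes g :: "nat \<Rightarrow> real"
  assumes A: "finite A" "card A \<ge> 3"
  shows "U_stat A x = 3 * (\<Sum>l \<in> A. g l) / card A
    + 6 * (\<Sum>t \<in> triples A. kern_at x t - (\<Sum>l \<in> indices t. g l))
      / (real (card A) * (real (card A) - 1) * (real (card A) - 2))"
proof -
  define N where "N = real (card A)"
  have N: "N \<ge> 3"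
    using A by (simp add: N_def)
  have "U_stat A x = (\<Sum>t \<in> triples A. kern_at x t) / (N * (N - 1) * (N - 2) / 6)"
    by (simp add: U_stat_def triples_def kern_at_def choose_three N_def)
  also have "(\<Sum>t \<in> triples A. kern_at x t)
      = (N - 1) * (N - 2) / 2 * (\<Sum>l \<in> A. g l)
        + (\<Sum>t \<in> triples A. kern_at x t - (\<Sum>l \<in> indices t. g l))"
    using sum_triples_indices[OF A(1), of g] by (simp add: sum_subtractf N_def)
  also have "\<dots> / (N * (N - 1) * (N - 2) / 6) = 3 * (\<Sum>l \<in> A. g l) / N
      + 6 * (\<Sum>t \<in> triples A. kern_at x t - (\<Sum>l \<in> indices t. g l)) / (N * (N - 1) * (N - 2))"
  proof -
    have "(P / 2 * a + b) / (N * P / 6) = 3 * a / N + 6 * b / (N * P)" if "P \<noteq> 0" for a b P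
      using N that by (simp add: field_simps)
    moreover have "(N - 1) * (N - 2) \<noteq> 0"
      using N by simp
    ultimately show ?thesis
      by (simp only: mult.assoc)
  qed
  finally show ?thesis
    by (simp add: N_def)
qed

text \<open>Decomposing the full and the reduced statistic with the same \<open>g\<close>, the
  linear parts differ by exactly \<open>3 * g i\<close>. The residuals of triples containing
  \<open>i\<close> keep a coefficient of order \<open>1/n^2\<close>, whereas those of all triples
  cancel down to order \<open>1/n^3\<close>. The bound \<open>n \<ge> 4\<close> leaves three
  observations after a deletion.\<close>

lemma pseudo_value_decomp:
  fixes g x :: "nat \<Rightarrow> real"
  assumes n: "n \<ge> 4" and i: "i \<in> {1..n}"
  defines "r t \<equiv> kern_at x t - (\<Sum>l \<in> indices t. g l)"
  shows "pseudo_value n x i = 3 * g i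
    + (6 * (\<Sum>t \<in> {t \<in> triples {1..n}. i \<in> indices t}. r t) / ((real n - 2) * (real n - 3))
      - 12 * (\<Sum>t \<in> triples {1..n}. r t) / ((real n - 1) * (real n - 2) * (real n - 3)))"
proof -
  define K where "K = (\<Sum>t \<in> triples {1..n}. r t)"
  define Ki where "Ki = (\<Sum>t \<in> {t \<in> triples {1..n}. i \<in> indices t}. r t)"
  define N where "N = real n"
  have N: "N \<ge> 4"
    using n by (simp add: N_def)
  have "(\<Sum>t \<in> triples {1..n}. r t) = Ki + (\<Sum>t \<in> triples ({1..n} - {i}). r t)"
    unfolding Ki_def triples_Diff
    using sum.inter_filter[of "triples {1..n}" r "\<lambda>t. i \<in> indices t"]
      sum.inter_filter[of "triples {1..n}" r "\<lambda>t. i \<notin> indices t"]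
    by (simp add: finite_triples flip: sum.distrib) (intro sum.cong, auto)
  then have K': "(\<Sum>t \<in> triples ({1..n} - {i}). r t) = K - Ki"
    by (simp add: K_def)
  have G': "(\<Sum>l \<in> {1..n} - {i}. g l) = (\<Sum>l \<in> {1..n}. g l) - g i"
    using i by (simp add: sum_diff1)
  have c: "card ({1..n} - {i}) = n - 1"
    using i by simp
  have 1: "N * U_stat {1..n} x = 3 * (\<Sum>l \<in> {1..n}. g l) + 6 * K / ((N - 1) * (N - 2))"
    using n N by (subst U_stat_decomp[where g = g]) (auto simp: K_def r_def N_def distrib_left)
  have 2: "(N - 1) * U_stat ({1..n} - {i}) x
      = 3 * ((\<Sum>l \<in> {1..n}. g l) - g i) + 6 * (K - Ki) / ((N - 2) * (N - 3))"
  proof -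
    have "U_stat ({1..n} - {i}) x = 3 * ((\<Sum>l \<in> {1..n}. g l) - g i) / (N - 1)
        + 6 * (K - Ki) / ((N - 1) * (N - 2) * (N - 3))"
      using n i K' by (subst U_stat_decomp[where g = g]) (auto simp: c G' r_def N_def of_nat_diff simp del: One_nat_def)
    then show ?thesis
      using N by (simp add: distrib_left)
  qed
  have "6 * K / ((N - 1) * (N - 2)) - 6 * (K - Ki) / ((N - 2) * (N - 3))
      = 6 * Ki / ((N - 2) * (N - 3)) - 12 * K / ((N - 1) * (N - 2) * (N - 3))"
  proof -
    define D where "D = (N - 1) * (N - 2) * (N - 3)"
    have "6 * K / ((N - 1) * (N - 2)) = 6 * K * (N - 3) / D"
      "6 * (K - Ki) / ((N - 2) * (N - 3)) = 6 * (K - Ki) * (N - 1) / D"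
      "6 * Ki / ((N - 2) * (N - 3)) = 6 * Ki * (N - 1) / D"
      using N by (simp_all add: D_def)
    moreover have "6 * K * (N - 3) - 6 * (K - Ki) * (N - 1) = 6 * Ki * (N - 1) - 12 * K"
      by (simp add: algebra_simps)
    ultimately show ?thesis
      unfolding D_def[symmetric] by (simp only: diff_divide_distrib[symmetric])
  qed
  then show ?thesis
    using 1 2 by (simp add: pseudo_value_def N_def K_def Ki_def)
qed

text \<open>The jackknife reproduces a U-statistic: in the sum over \<open>i\<close> each triple is
  counted by its three indices. Comparing means through this identity gives a mean square error of
  order \<open>1/n^2\<close>, while bounding the individual errors would give only
  \<open>1/n\<close>.\<close>

lemma mean_pseudo_value:
  assumes n: "n \<ge> 4"
  shows "(\<Sum>i = 1..n. pseudo_value n x i) / n = U_stat {1..n} x"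
proof -
  define K where "K = (\<Sum>t \<in> triples {1..n}. kern_at x t)"
  define N where "N = real n"
  have N: "N \<ge> 4"
    using n by (simp add: N_def)
  have "(\<Sum>i = 1..n. pseudo_value n x i)
      = (\<Sum>i = 1..n. 6 / ((N - 2) * (N - 3)) * (\<Sum>t \<in> {t \<in> triples {1..n}. i \<in> indices t}. kern_at x t)
          - 12 * K / ((N - 1) * (N - 2) * (N - 3)))"
    using pseudo_value_decomp[OF n, where g = "\<lambda>_. 0" and x = x]
    by (intro sum.cong refl) (simp add: N_def K_def)
  also have "\<dots> = 6 / ((N - 2) * (N - 3)) * (3 * K) - N * (12 * K / ((N - 1) * (N - 2) * (N - 3)))"
    unfolding sum_subtractf sum_distrib_left[symmetric]
    by (subst sum_triples_containing) (simp_all add: K_def N_def)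
  also have "\<dots> = 6 * K / ((N - 1) * (N - 2))"
    using N by (simp add: divide_simps) (simp add: algebra_simps)
  also have "\<dots> = N * U_stat {1..n} x"
    using n N by (subst U_stat_decomp[where g = "\<lambda>_. 0"]) (auto simp: K_def N_def)
  finally show ?thesis
    using n by (simp add: N_def)
qed

text \<open>Two of the three positions of \<open>t'\<close> are filled from the at most three
  indices of \<open>t\<close> and the third is free: \<open>3 * 3 * 3 * n\<close>.\<close>

lemma card_overlap_le:
  "card {t' \<in> triples {1..n}. overlap t t'} \<le> 27 * n"
proof -
  define I where "I = indices t"
  have I: "finite I" "card I \<le> 3"
    by (auto simp: I_def indices_def card_insert_if split: prod.splits)
  have "{t' \<in> triples {1..n}. overlap t t'}
      \<subseteq> (I \<times> I \<times> {1..n}) \<union> (I \<times> {1..n} \<times> I) \<union> ({1..n} \<times> I \<times> I)"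
  proof
    fix t' assume "t' \<in> {t' \<in> triples {1..n}. overlap t t'}"
    then obtain a b c where t': "t' = (a, b, c)" "a \<in> {1..n}" "b \<in> {1..n}" "c \<in> {1..n}" "overlap t t'"
      by (auto simp: triples_def)
    then obtain p q where "p \<noteq> q" "p \<in> I" "q \<in> I" "p \<in> {a, b, c}" "q \<in> {a, b, c}"
      by (auto simp: overlap_def I_def indices_def)
    then have "a \<in> I \<and> b \<in> I \<or> a \<in> I \<and> c \<in> I \<or> b \<in> I \<and> c \<in> I"
      by auto
    then show "t' \<in> (I \<times> I \<times> {1..n}) \<union> (I \<times> {1..n} \<times> I) \<union> ({1..n} \<times> I \<times> I)"
      using t' by blast
  qed
  then have "card {t' \<in> triples {1..n}. overlap t t'}
      \<le> card ((I \<times> I \<times> {1..n}) \<union> (I \<times> {1..n} \<times> I) \<union> ({1..n} \<times> I \<times> I))"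
    using I by (intro card_mono) auto
  also have "\<dots> \<le> card (I \<times> I \<times> {1..n}) + card (I \<times> {1..n} \<times> I) + card ({1..n} \<times> I \<times> I)"
    by (meson add_le_mono card_Un_le le_refl order_trans)
  also have "\<dots> = 3 * (card I * card I) * n"
    by (simp add: card_cartesian_product)
  also have "\<dots> \<le> 3 * (3 * 3) * n"
    using I by (intro mult_le_mono le_refl) auto
  finally show ?thesis
    by simp
qed

subsection \<open>The projection of the kernel\<close>

lemma kern_bound: "\<bar>kern x y z\<bar> \<le> \<bar>x\<bar> + \<bar>y\<bar> + \<bar>z\<bar>"
proof -
  define a b where ab: "a = max x (max y z)" "b = min x (min y z)"
  have k: "kern x y z = (a + b) / 2 - (x + y + z) / 3"
    unfolding kern_def ab[symmetric] by (simp add: field_simps)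
  have "a \<in> {x, y, z}" "b \<in> {x, y, z}"
    by (auto simp: ab max_def min_def)
  moreover have "\<forall>a \<in> {x, y, z}. \<forall>b \<in> {x, y, z}. \<bar>(a + b) / 2 - (x + y + z) / 3\<bar> \<le> \<bar>x\<bar> + \<bar>y\<bar> + \<bar>z\<bar>"
    by (intro ballI, elim insertE emptyE, simp_all only:) argo+
  ultimately show ?thesis
    unfolding k by blast
qed

lemma kern_commute: "kern x y z = kern y x z" "kern x y z = kern x z y"
  unfolding kern_def by (simp_all add: max.left_commute max.commute min.left_commute min.commute)

text \<open>Reflection exchanges maximum and minimum, so it reflects the midrange as well as the
  mean, and their difference changes sign.\<close>

lemma kern_reflect: "kern (2 * m - x) (2 * m - y) (2 * m - z) = - kern x y z"
proof -
  have "max (2 * m - a) (2 * m - b) = 2 * m - min a b" "min (2 * m - a) (2 * m - b) = 2 * m - max a b"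
    for a b
    by (simp_all add: max_def min_def)
  then show ?thesis
    unfolding kern_def by (simp only:) (simp add: field_simps)
qed

lemma measurable_kern [measurable (raw)]:
  assumes "f \<in> borel_measurable N" "g \<in> borel_measurable N" "h \<in> borel_measurable N"
  shows "(\<lambda>w. kern (f w) (g w) (h w)) \<in> borel_measurable N"
  using assms unfolding kern_def by measurable

section \<open>Integration over one observation, over pairs and over disjoint blocks\<close>

locale iid_sample = prob_space +
  fixes X :: "nat \<Rightarrow> 'a \<Rightarrow> real" and D :: "real measure"
  assumes indep: "indep_vars (\<lambda>_. borel) X {1..}"
    and law: "\<And>i. i \<ge> 1 \<Longrightarrow> distr M borel (X i) = D"
    and square_integrable: "integrable D (\<lambda>x. x\<^sup>2)"
begin

lemma X_measurable [measurable]: "i \<ge> 1 \<Longrightarrow> X i \<in> borel_measurable M"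
  using indep by (auto simp: indep_vars_def2)

lemma sets_D [simp, measurable_cong]: "sets D = sets borel"
  using law[of 1] sets_distr[of M borel "X 1"] by simp

lemma space_D [simp]: "space D = UNIV"
  using sets_eq_imp_space_eq[OF sets_D] by simp

sublocale D: prob_space D
  using prob_space_distr[of "X 1" borel] law[of 1] by simp

sublocale DD: pair_prob_space D D ..

lemma integrable_X_iff:
  fixes \<phi> :: "real \<Rightarrow> real"
  assumes "i \<ge> 1" "\<phi> \<in> borel_measurable borel"
  shows "integrable M (\<lambda>\<omega>. \<phi> (X i \<omega>)) \<longleftrightarrow> integrable D \<phi>"
  using assms by (subst law[symmetric, of i]) (auto simp: integrable_distr_eq)

lemma expectation_X:
  fixes \<phi> :: "real \<Rightarrow> real"
  assumes "i \<ge> 1" "\<phi> \<in> borel_measurable borel"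
  shows "expectation (\<lambda>\<omega>. \<phi> (X i \<omega>)) = D.expectation \<phi>"
  using assms by (subst law[symmetric, of i]) (auto simp: integral_distr)

lemma integrable_square: "i \<ge> 1 \<Longrightarrow> integrable M (\<lambda>\<omega>. (X i \<omega>)\<^sup>2)"
  using square_integrable by (subst integrable_X_iff) auto

lemma integrable_X: "i \<ge> 1 \<Longrightarrow> integrable M (X i)"
  by (rule square_integrable_imp_integrable[OF X_measurable integrable_square])

lemma pair_law:
  assumes "j \<ge> 1" "l \<ge> 1" "j \<noteq> l"
  shows "distr M (borel \<Otimes>\<^sub>M borel) (\<lambda>\<omega>. (X j \<omega>, X l \<omega>)) = D \<Otimes>\<^sub>M D"
proof -
  \<comment> \<open>Independence of two members is extracted from independence of blocks: restrict
    the family to two singletons, then evaluate.\<close>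
  have "indep_var (PiM {j} (\<lambda>_. borel)) (\<lambda>\<omega>. restrict (\<lambda>i. X i \<omega>) {j})
      (PiM {l} (\<lambda>_. borel)) (\<lambda>\<omega>. restrict (\<lambda>i. X i \<omega>) {l})"
    using assms by (intro indep_var_restrict[OF indep]) auto
  then have "indep_var borel ((\<lambda>f. f j) \<circ> (\<lambda>\<omega>. restrict (\<lambda>i. X i \<omega>) {j}))
      borel ((\<lambda>f. f l) \<circ> (\<lambda>\<omega>. restrict (\<lambda>i. X i \<omega>) {l}))"
    by (rule indep_var_compose) auto
  then have "indep_var borel (X j) borel (X l)"
    by (simp add: comp_def)
  then have "distr M borel (X j) \<Otimes>\<^sub>M distr M borel (X l) = distr M (borel \<Otimes>\<^sub>M borel) (\<lambda>\<omega>. (X j \<omega>, X l \<omega>))"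
    by (simp add: indep_var_distribution_eq)
  then show ?thesis
    using assms by (simp add: law)
qed

lemma integrable_pair_iff:
  fixes \<phi> :: "real \<times> real \<Rightarrow> real"
  assumes "j \<ge> 1" "l \<ge> 1" "j \<noteq> l" "\<phi> \<in> borel_measurable (borel \<Otimes>\<^sub>M borel)"
  shows "integrable M (\<lambda>\<omega>. \<phi> (X j \<omega>, X l \<omega>)) \<longleftrightarrow> integrable (D \<Otimes>\<^sub>M D) \<phi>"
  using assms by (subst pair_law[symmetric, of j l]) (auto simp: integrable_distr_eq)

lemma expectation_pair:
  fixes \<phi> :: "real \<times> real \<Rightarrow> real"
  assumes "j \<ge> 1" "l \<ge> 1" "j \<noteq> l" "\<phi> \<in> borel_measurable (borel \<Otimes>\<^sub>M borel)"
  shows "expectation (\<lambda>\<omega>. \<phi> (X j \<omega>, X l \<omega>)) = integral\<^sup>L (D \<Otimes>\<^sub>M D) \<phi>"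
  using assms by (subst pair_law[symmetric, of j l]) (auto simp: integral_distr)

text \<open>The pair of observations \<open>j\<close>, \<open>l\<close> is independent of those in \<open>B\<close>, so it can be
  integrated out first.\<close>

lemma degenerate_orthogonal:
  fixes K :: "real \<times> real \<times> real \<Rightarrow> real" and \<phi> :: "(nat \<Rightarrow> real) \<Rightarrow> real"
  assumes K [measurable]: "K \<in> borel_measurable (borel \<Otimes>\<^sub>M borel \<Otimes>\<^sub>M borel)"
    and zero: "\<And>x. (\<integral>p. K (x, p) \<partial>(D \<Otimes>\<^sub>M D)) = 0"
    and jl: "j \<ge> 1" "l \<ge> 1" "j \<noteq> l" "j \<notin> B" "l \<notin> B" and B: "B \<subseteq> {1..}" "i \<in> B"
    and \<phi> [measurable]: "\<phi> \<in> borel_measurable (PiM B (\<lambda>_. borel))"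
    and int: "integrable M (\<lambda>\<omega>. K (X i \<omega>, X j \<omega>, X l \<omega>) * \<phi> (restrict (\<lambda>i. X i \<omega>) B))"
  shows "expectation (\<lambda>\<omega>. K (X i \<omega>, X j \<omega>, X l \<omega>) * \<phi> (restrict (\<lambda>i. X i \<omega>) B)) = 0"
proof -
  let ?S = "\<lambda>A. PiM A (\<lambda>_. borel :: real measure)"
  let ?R = "\<lambda>A \<omega>. restrict (\<lambda>i. X i \<omega>) A"
  let ?Q = "\<lambda>A. distr M (?S A) (?R A)"
  let ?\<psi> = "\<lambda>a b. K (b i, a j, a l) * \<phi> b"
  have R [measurable]: "?R A \<in> measurable M (?S A)" if "A \<subseteq> {1..}" for A
    using that by (intro measurable_restrict) auto
  have A: "{j, l} \<subseteq> {1..}"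
    using jl by auto
  interpret A: prob_space "?Q {j, l}"
    by (rule prob_space_distr[OF R[OF A]])
  interpret B: prob_space "?Q B"
    by (rule prob_space_distr[OF R[OF B(1)]])
  interpret P: pair_prob_space "?Q {j, l}" "?Q B" ..
  have i [measurable]: "(\<lambda>b. b i) \<in> borel_measurable (?S B)"
    using B by measurable
  have jl' [measurable]: "(\<lambda>b. b j) \<in> borel_measurable (?S {j, l})" "(\<lambda>b. b l) \<in> borel_measurable (?S {j, l})"
    by measurable
  have "indep_var (?S {j, l}) (?R {j, l}) (?S B) (?R B)"
    using jl B by (intro indep_var_restrict[OF indep]) auto
  then have joint: "?Q {j, l} \<Otimes>\<^sub>M ?Q B = distr M (?S {j, l} \<Otimes>\<^sub>M ?S B) (\<lambda>\<omega>. (?R {j, l} \<omega>, ?R B \<omega>))"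
    by (simp add: indep_var_distribution_eq)
  have \<psi> [measurable]: "(\<lambda>(a, b). ?\<psi> a b) \<in> borel_measurable (?S {j, l} \<Otimes>\<^sub>M ?S B)"
    by measurable
  have map [measurable]: "(\<lambda>\<omega>. (?R {j, l} \<omega>, ?R B \<omega>)) \<in> measurable M (?S {j, l} \<Otimes>\<^sub>M ?S B)"
    using R[OF A] R[OF B(1)] by measurable
  \<comment> \<open>With the observation \<open>i\<close> frozen at \<open>x\<close>, the inner
    Fubini integral is the one assumed to vanish; the factor \<open>\<phi> b\<close> does not depend
    on \<open>a\<close> and comes out.\<close>
  have inner: "integral\<^sup>L (?Q {j, l}) (\<lambda>a. K (x, a j, a l)) = 0" for x
  proof -
    have "integral\<^sup>L (?Q {j, l}) (\<lambda>a. K (x, a j, a l)) = expectation (\<lambda>\<omega>. K (x, X j \<omega>, X l \<omega>))"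
      by (subst integral_distr[OF R[OF A]]) simp_all
    also have "\<dots> = 0"
      using expectation_pair[of j l "\<lambda>p. K (x, p)"] jl zero by simp
    finally show ?thesis .
  qed
  have "integrable (?Q {j, l} \<Otimes>\<^sub>M ?Q B) (\<lambda>(a, b). ?\<psi> a b)"
    unfolding joint using int B by (subst integrable_distr_eq[OF map \<psi>]) simp
  from P.integral_snd[OF this]
  have "integral\<^sup>L (?Q {j, l} \<Otimes>\<^sub>M ?Q B) (\<lambda>(a, b). ?\<psi> a b) = (\<integral>b. (\<integral>a. ?\<psi> a b \<partial>?Q {j, l}) \<partial>?Q B)"
    by simp
  also have "\<dots> = 0"
    by (simp add: inner)
  finally have "integral\<^sup>L (?Q {j, l} \<Otimes>\<^sub>M ?Q B) (\<lambda>(a, b). ?\<psi> a b) = 0" .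
  then show ?thesis
    unfolding joint using B by (subst (asm) integral_distr[OF map \<psi>]) simp
qed

definition proj :: "real \<Rightarrow> real" where
  "proj x = (\<integral>p. kern x (fst p) (snd p) \<partial>(D \<Otimes>\<^sub>M D))"

definition mean_abs :: real where
  "mean_abs = (\<integral>x. \<bar>x\<bar> \<partial>D)"

lemma integrable_D: "integrable D (\<lambda>x. x)"
  using integrable_X[of 1] integrable_X_iff[of 1 "\<lambda>x. x"] by simp

lemma integrable_fst_DD: "integrable (D \<Otimes>\<^sub>M D) fst"
  and integrable_snd_DD: "integrable (D \<Otimes>\<^sub>M D) snd"
  using integrable_pair_iff[of 1 2 fst] integrable_pair_iff[of 1 2 snd] integrable_X[of 1] integrable_X[of 2]
  by simp_all

lemma integral_marginal_DD:
  fixes \<phi> :: "real \<Rightarrow> real"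
  assumes "\<phi> \<in> borel_measurable borel"
  shows "(\<integral>p. \<phi> (fst p) \<partial>(D \<Otimes>\<^sub>M D)) = (\<integral>x. \<phi> x \<partial>D)" "(\<integral>p. \<phi> (snd p) \<partial>(D \<Otimes>\<^sub>M D)) = (\<integral>x. \<phi> x \<partial>D)"
  using assms expectation_pair[of 1 2 "\<lambda>p. \<phi> (fst p)"] expectation_pair[of 1 2 "\<lambda>p. \<phi> (snd p)"]
  expectation_X[of 1 \<phi>] expectation_X[of 2 \<phi>]
  by simp_all

lemma integrable_kern: "integrable (D \<Otimes>\<^sub>M D) (\<lambda>p. kern x (fst p) (snd p))"
proof (rule Bochner_Integration.integrable_bound)
  show "integrable (D \<Otimes>\<^sub>M D) (\<lambda>p. \<bar>x\<bar> + \<bar>fst p\<bar> + \<bar>snd p\<bar>)"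
    by (intro Bochner_Integration.integrable_add integrable_abs integrable_fst_DD integrable_snd_DD) simp
qed (use kern_bound in \<open>auto simp: abs_le_iff\<close>)

lemma measurable_proj [measurable]: "proj \<in> borel_measurable borel"
proof -
  have "(\<lambda>x. \<integral>p. kern x (fst p) (snd p) \<partial>(D \<Otimes>\<^sub>M D)) \<in> borel_measurable borel"
    by measurable
  then show ?thesis
    by (simp add: proj_def[abs_def])
qed

lemma proj_bound: "\<bar>proj x\<bar> \<le> \<bar>x\<bar> + 2 * mean_abs"
proof -
  have "\<bar>proj x\<bar> \<le> (\<integral>p. \<bar>kern x (fst p) (snd p)\<bar> \<partial>(D \<Otimes>\<^sub>M D))"
    unfolding proj_def by (rule integral_abs_bound)
  also have "\<dots> \<le> (\<integral>p. \<bar>x\<bar> + \<bar>fst p\<bar> + \<bar>snd p\<bar> \<partial>(D \<Otimes>\<^sub>M D))"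
    by (intro integral_mono integrable_abs integrable_kern Bochner_Integration.integrable_add
        integrable_fst_DD integrable_snd_DD kern_bound) simp
  also have "\<dots> = \<bar>x\<bar> + 2 * mean_abs"
    by (simp add: integrable_fst_DD integrable_snd_DD integral_marginal_DD[of abs] mean_abs_def DD.P.prob_space)
  finally show ?thesis .
qed

end

text \<open>Symmetry is encoded as invariance of the law under reflection, the form needed for
  changes of variable. Absolute continuity enters as absence of atoms.\<close>

locale symmetric_sample = iid_sample +
  fixes m :: real
  assumes reflect: "distr D borel (\<lambda>x. 2 * m - x) = D"
    and no_atoms: "\<And>x. measure D {x} = 0"
begin

lemma integral_reflect:
  fixes \<phi> :: "real \<Rightarrow> real"
  assumes [measurable]: "\<phi> \<in> borel_measurable borel"
  shows "(\<integral>x. \<phi> (2 * m - x) \<partial>D) = (\<integral>x. \<phi> x \<partial>D)"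
proof -
  have "(\<integral>x. \<phi> x \<partial>distr D borel (\<lambda>x. 2 * m - x)) = (\<integral>x. \<phi> (2 * m - x) \<partial>D)"
    by (rule integral_distr) auto
  then show ?thesis
    by (simp add: reflect)
qed

text \<open>The law of an independent pair is invariant under reflecting both coordinates, so the
  oddness of the kernel passes to its projection. An odd function has integral 0 under a symmetric
  law.\<close>

lemma proj_reflect: "proj (2 * m - x) = - proj x"
proof -
  let ?\<rho> = "\<lambda>x::real. 2 * m - x"
  have "distr D borel ?\<rho> \<Otimes>\<^sub>M distr D borel ?\<rho> = distr (D \<Otimes>\<^sub>M D) (borel \<Otimes>\<^sub>M borel) (\<lambda>(x, y). (?\<rho> x, ?\<rho> y))"
    by (rule pair_measure_distr) (auto simp: reflect D.sigma_finite_measure_axioms)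
  then have eq: "D \<Otimes>\<^sub>M D = distr (D \<Otimes>\<^sub>M D) (borel \<Otimes>\<^sub>M borel) (\<lambda>(x, y). (?\<rho> x, ?\<rho> y))"
    by (simp add: reflect)
  have "proj (?\<rho> x) = (\<integral>p. kern (?\<rho> x) (fst p) (snd p) \<partial>distr (D \<Otimes>\<^sub>M D) (borel \<Otimes>\<^sub>M borel) (\<lambda>(x, y). (?\<rho> x, ?\<rho> y)))"
    unfolding proj_def by (subst eq) (rule refl)
  also have "\<dots> = (\<integral>p. kern (?\<rho> x) (?\<rho> (fst p)) (?\<rho> (snd p)) \<partial>(D \<Otimes>\<^sub>M D))"
    by (subst integral_distr) (auto simp: case_prod_unfold)
  also have "\<dots> = - proj x"
    by (simp add: kern_reflect proj_def)
  finally show ?thesis .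
qed

lemma integral_proj: "(\<integral>x. proj x \<partial>D) = 0"
  using integral_reflect[of proj] by (simp add: proj_reflect)

lemma integrable_proj: "integrable D proj"
proof (rule Bochner_Integration.integrable_bound)
  show "integrable D (\<lambda>x. \<bar>x\<bar> + 2 * mean_abs)"
    using integrable_D by simp
  have "norm (proj x) \<le> norm (\<bar>x\<bar> + 2 * mean_abs)" for x
    using order_trans[OF proj_bound abs_ge_self] by simp
  then show "AE x in D. norm (proj x) \<le> norm (\<bar>x\<bar> + 2 * mean_abs)"
    by simp
qed simp

definition resid :: "real \<times> real \<times> real \<Rightarrow> real" where
  "resid = (\<lambda>(x, y, z). kern x y z - proj x - proj y - proj z)"

lemma measurable_resid [measurable]: "resid \<in> borel_measurable (borel \<Otimes>\<^sub>M borel \<Otimes>\<^sub>M borel)"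
  unfolding resid_def by measurable

text \<open>The kernel integrates to \<open>proj x\<close>, which the term \<open>proj x\<close>
  cancels; the other two terms vanish because \<open>proj\<close> is centred.\<close>

lemma integral_resid: "(\<integral>p. resid (x, p) \<partial>(D \<Otimes>\<^sub>M D)) = 0"
proof -
  have i: "integrable (D \<Otimes>\<^sub>M D) (\<lambda>p. proj (fst p))" "integrable (D \<Otimes>\<^sub>M D) (\<lambda>p. proj (snd p))"
    using integrable_proj integrable_pair_iff[of 1 2 "\<lambda>p. proj (fst p)"] integrable_pair_iff[of 1 2 "\<lambda>p. proj (snd p)"]
      integrable_X_iff[of 1 proj] integrable_X_iff[of 2 proj] by simp_all
  have "(\<integral>p. resid (x, p) \<partial>(D \<Otimes>\<^sub>M D))
      = (\<integral>p. kern x (fst p) (snd p) - proj x - proj (fst p) - proj (snd p) \<partial>(D \<Otimes>\<^sub>M D))"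
    by (simp add: resid_def case_prod_unfold)
  also have "\<dots> = (\<integral>p. kern x (fst p) (snd p) \<partial>(D \<Otimes>\<^sub>M D)) - (\<integral>p. proj x \<partial>(D \<Otimes>\<^sub>M D))
      - (\<integral>p. proj (fst p) \<partial>(D \<Otimes>\<^sub>M D)) - (\<integral>p. proj (snd p) \<partial>(D \<Otimes>\<^sub>M D))"
    by (subst Bochner_Integration.integral_diff Bochner_Integration.integrable_diff;
        (intro Bochner_Integration.integrable_diff integrable_kern i DD.P.integrable_const)?)+ (rule refl)
  also have "\<dots> = 0"
    by (simp add: integral_marginal_DD integral_proj proj_def[of x, symmetric] DD.P.prob_space)
  finally show ?thesis .
qed

text \<open>The expectation of the majorant in \<open>resid_square_le\<close> at three sample
  points, with \<open>48 = 3 * 16\<close>. It bounds the second moment of every residual.\<close>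

definition resid_bound :: real where
  "resid_bound = 48 * (\<integral>x. x\<^sup>2 \<partial>D) + 144 * mean_abs\<^sup>2"

lemma resid_square_le: "(resid (x, y, z))\<^sup>2 \<le> 16 * (x\<^sup>2 + y\<^sup>2 + z\<^sup>2) + 144 * mean_abs\<^sup>2"
proof -
  have four: "(a + b + c + d)\<^sup>2 \<le> 4 * (a\<^sup>2 + b\<^sup>2 + c\<^sup>2 + d\<^sup>2)" for a b c d :: real
  proof -
    have "0 \<le> (a - b)\<^sup>2 + (a - c)\<^sup>2 + (a - d)\<^sup>2 + (b - c)\<^sup>2 + (b - d)\<^sup>2 + (c - d)\<^sup>2"
      by simp
    then show ?thesis
      by (simp add: power2_eq_square algebra_simps)
  qed
  have "\<bar>resid (x, y, z)\<bar> \<le> \<bar>kern x y z\<bar> + \<bar>proj x\<bar> + \<bar>proj y\<bar> + \<bar>proj z\<bar>"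
    by (simp add: resid_def)
  also have "\<dots> \<le> 2 * \<bar>x\<bar> + 2 * \<bar>y\<bar> + 2 * \<bar>z\<bar> + 6 * mean_abs"
    using kern_bound[of x y z] proj_bound[of x] proj_bound[of y] proj_bound[of z] by linarith
  finally have "(resid (x, y, z))\<^sup>2 \<le> (2 * \<bar>x\<bar> + 2 * \<bar>y\<bar> + 2 * \<bar>z\<bar> + 6 * mean_abs)\<^sup>2"
    using power_mono[of "\<bar>resid (x, y, z)\<bar>" _ 2] by simp
  also have "\<dots> \<le> 16 * (x\<^sup>2 + y\<^sup>2 + z\<^sup>2) + 144 * mean_abs\<^sup>2"
    using four[of "2 * \<bar>x\<bar>" "2 * \<bar>y\<bar>" "2 * \<bar>z\<bar>" "6 * mean_abs"] by (simp add: power_mult_distrib)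
  finally show ?thesis .
qed

text \<open>The residual in the shape in which the decompositions produce it, a function of the
  whole sample and a triple. On decreasing triples it agrees with \<open>resid\<close>, which is the
  version suited to integration.\<close>

definition resid_at :: "(nat \<Rightarrow> real) \<Rightarrow> nat \<times> nat \<times> nat \<Rightarrow> real" where
  "resid_at x t = kern_at x t - (\<Sum>l \<in> indices t. proj (x l))"

lemma resid_at_eq: "t \<in> triples A \<Longrightarrow> t = (i, j, l) \<Longrightarrow> resid_at x t = resid (x i, x j, x l)"
  by (auto simp: resid_at_def resid_def kern_at_def indices_def triples_def)

lemma resid_at_restrict: "indices t \<subseteq> B \<Longrightarrow> resid_at (restrict x B) t = resid_at x t"
  by (cases t) (auto simp: resid_at_def kern_at_def indices_def intro!: sum.cong)

lemma resid_at_measurable: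
  assumes "indices t \<subseteq> B"
  shows "(\<lambda>x. resid_at x t) \<in> borel_measurable (PiM B (\<lambda>_. borel))"
proof -
  have [measurable]: "(\<lambda>x. x l) \<in> borel_measurable (PiM B (\<lambda>_. borel))" if "l \<in> indices t" for l
    using that assms by (auto intro!: measurable_component_singleton)
  have "(\<lambda>x. kern_at x t) \<in> borel_measurable (PiM B (\<lambda>_. borel))"
    using assms by (cases t) (auto simp: kern_at_def indices_def)
  moreover have "(\<lambda>x. \<Sum>l \<in> indices t. proj (x l)) \<in> borel_measurable (PiM B (\<lambda>_. borel))"
    by (rule borel_measurable_sum) measurable
  ultimately show ?thesis
    unfolding resid_at_def by (rule borel_measurable_diff)
qed

lemma resid_at_X_measurable [measurable]:
  assumes "t \<in> triples {1..}"
  shows "(\<lambda>\<omega>. resid_at (\<lambda>i. X i \<omega>) t) \<in> borel_measurable M"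
proof -
  obtain i j l where t: "t = (i, j, l)" by (cases t)
  have [measurable]: "X i \<in> borel_measurable M" "X j \<in> borel_measurable M" "X l \<in> borel_measurable M"
    using assms t by (auto simp: triples_def)
  show ?thesis
    unfolding resid_at_eq[OF assms t] by measurable
qed

lemma integrable_resid_at_square:
  assumes "t \<in> triples {1..}"
  shows "integrable M (\<lambda>\<omega>. (resid_at (\<lambda>i. X i \<omega>) t)\<^sup>2)"
    and "expectation (\<lambda>\<omega>. (resid_at (\<lambda>i. X i \<omega>) t)\<^sup>2) \<le> resid_bound"
proof -
  obtain i j l where t: "t = (i, j, l)" by (cases t)
  have ge: "i \<ge> 1" "j \<ge> 1" "l \<ge> 1"
    using assms t by (auto simp: triples_def)
  let ?b = "\<lambda>\<omega>. 16 * ((X i \<omega>)\<^sup>2 + (X j \<omega>)\<^sup>2 + (X l \<omega>)\<^sup>2) + 144 * mean_abs\<^sup>2"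
  have le: "(resid_at (\<lambda>i. X i \<omega>) t)\<^sup>2 \<le> ?b \<omega>" for \<omega>
    unfolding resid_at_eq[OF assms t] by (rule resid_square_le)
  have b: "integrable M ?b"
    using ge integrable_square by simp
  show int: "integrable M (\<lambda>\<omega>. (resid_at (\<lambda>i. X i \<omega>) t)\<^sup>2)"
    by (rule Bochner_Integration.integrable_bound[OF b])
      (use le assms in \<open>auto simp: abs_le_iff intro: order_trans\<close>)
  have "expectation (\<lambda>\<omega>. (resid_at (\<lambda>i. X i \<omega>) t)\<^sup>2) \<le> expectation ?b"
    by (rule integral_mono[OF int b le])
  also have "\<dots> = resid_bound"
    using ge integrable_square expectation_X[of _ "\<lambda>x. x\<^sup>2"] by (simp add: resid_bound_def prob_space)
  finally show "expectation (\<lambda>\<omega>. (resid_at (\<lambda>i. X i \<omega>) t)\<^sup>2) \<le> resid_bound" .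
qed

lemma resid_at_product:
  assumes t: "t \<in> triples {1..}" "t' \<in> triples {1..}"
  shows "integrable M (\<lambda>\<omega>. resid_at (\<lambda>i. X i \<omega>) t * resid_at (\<lambda>i. X i \<omega>) t')"
    and "expectation (\<lambda>\<omega>. resid_at (\<lambda>i. X i \<omega>) t * resid_at (\<lambda>i. X i \<omega>) t') \<le> resid_bound"
proof -
  let ?r = "\<lambda>\<omega>. resid_at (\<lambda>i. X i \<omega>)"
  note int = integrable_resid_at_square[OF t(1)] integrable_resid_at_square[OF t(2)]
  have le: "\<bar>?r \<omega> t * ?r \<omega> t'\<bar> \<le> ((?r \<omega> t)\<^sup>2 + (?r \<omega> t')\<^sup>2) / 2" for \<omega>
    using sum_squares_bound[of "\<bar>?r \<omega> t\<bar>" "\<bar>?r \<omega> t'\<bar>"] by (simp add: abs_mult)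
  show i: "integrable M (\<lambda>\<omega>. ?r \<omega> t * ?r \<omega> t')"
    by (rule Bochner_Integration.integrable_bound[of _ "\<lambda>\<omega>. ((?r \<omega> t)\<^sup>2 + (?r \<omega> t')\<^sup>2) / 2"])
      (use int t le in auto)
  have "expectation (\<lambda>\<omega>. ?r \<omega> t * ?r \<omega> t') \<le> expectation (\<lambda>\<omega>. ((?r \<omega> t)\<^sup>2 + (?r \<omega> t')\<^sup>2) / 2)"
    using int by (intro integral_mono i order_trans[OF abs_ge_self le]) simp
  also have "\<dots> = (expectation (\<lambda>\<omega>. (?r \<omega> t)\<^sup>2) + expectation (\<lambda>\<omega>. (?r \<omega> t')\<^sup>2)) / 2"
    using int by simp
  also have "\<dots> \<le> resid_bound"
    using int by simp
  finally show "expectation (\<lambda>\<omega>. ?r \<omega> t * ?r \<omega> t') \<le> resid_bound" .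
qed

text \<open>If at most one index is shared, two indices of \<open>t\<close> do not occur in
  \<open>t'\<close>. Integrating out these two while everything else is fixed gives 0 by
  \<open>integral_resid\<close>; since the residual is symmetric, the index that stays may be moved
  to the first place.\<close>

lemma resid_at_orthogonal:
  assumes t: "t \<in> triples {1..}" "t' \<in> triples {1..}" and no: "\<not> overlap t t'"
  shows "expectation (\<lambda>\<omega>. resid_at (\<lambda>i. X i \<omega>) t * resid_at (\<lambda>i. X i \<omega>) t') = 0"
proof -
  obtain a b c where abc: "t = (a, b, c)" by (cases t)
  have dist: "a \<ge> 1" "b \<ge> 1" "c \<ge> 1" "a \<noteq> b" "a \<noteq> c" "b \<noteq> c"
    using t abc by (auto simp: triples_def)
  have sym: "resid (x, y, z) = resid (y, x, z)" "resid (x, y, z) = resid (z, x, y)" for x y z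
    using kern_commute by (auto simp: resid_def)
  have *: "expectation (\<lambda>\<omega>. resid_at (\<lambda>i. X i \<omega>) t * resid_at (\<lambda>i. X i \<omega>) t') = 0"
    if ijl: "i \<ge> 1" "j \<ge> 1" "l \<ge> 1" "j \<noteq> l" "i \<noteq> j" "i \<noteq> l" "j \<notin> indices t'" "l \<notin> indices t'"
      and eq: "\<And>x. resid_at x t = resid (x i, x j, x l)" for i j l
  proof -
    \<comment> \<open>The index \<open>i\<close> that stays is added even if it is not in
      \<open>t'\<close>, so that all frozen observations form one block disjoint from
      \<open>j\<close> and \<open>l\<close>.\<close>
    let ?B = "insert i (indices t')"
    have B: "indices t' \<subseteq> ?B" by auto
    have "integrable M (\<lambda>\<omega>. resid (X i \<omega>, X j \<omega>, X l \<omega>) * resid_at (restrict (\<lambda>i. X i \<omega>) ?B) t')"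
      using resid_at_product(1)[OF t] by (simp add: eq resid_at_restrict[OF B])
    then have "expectation (\<lambda>\<omega>. resid (X i \<omega>, X j \<omega>, X l \<omega>) * resid_at (restrict (\<lambda>i. X i \<omega>) ?B) t') = 0"
      using ijl indices_subset[OF t(2)]
      by (intro degenerate_orthogonal[OF measurable_resid integral_resid, where \<phi> = "\<lambda>f. resid_at f t'" and i = i]
          resid_at_measurable) auto
    then show ?thesis
      by (simp add: eq resid_at_restrict[OF B])
  qed
  have "b \<notin> indices t' \<and> c \<notin> indices t' \<or> a \<notin> indices t' \<and> c \<notin> indices t' \<or> a \<notin> indices t' \<and> b \<notin> indices t'"
    using no dist by (auto simp: overlap_def abc indices_def)
  moreover have "resid_at x t = resid (x a, x b, x c)" "resid_at x t = resid (x b, x a, x c)"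
    "resid_at x t = resid (x c, x a, x b)" for x
    using resid_at_eq[OF t(1) abc] sym by metis+
  ultimately show ?thesis
    using dist *[of a b c] *[of b a c] *[of c a b] by metis
qed

text \<open>Only pairs of triples sharing at least two indices contribute.\<close>

lemma resid_sum_square:
  assumes T: "T \<subseteq> triples {1..n}"
  shows "integrable M (\<lambda>\<omega>. (\<Sum>t \<in> T. resid_at (\<lambda>i. X i \<omega>) t)\<^sup>2)"
    and "expectation (\<lambda>\<omega>. (\<Sum>t \<in> T. resid_at (\<lambda>i. X i \<omega>) t)\<^sup>2) \<le> 27 * resid_bound * real (card T) * real n"
proof -
  let ?r = "\<lambda>\<omega>. resid_at (\<lambda>i. X i \<omega>)"
  have T1: "t \<in> triples {1..}" if "t \<in> T" for t
    using that T by (auto simp: triples_def)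
  have fin: "finite T"
    using T finite_triples[of "{1..n}"] finite_subset by auto
  have sq: "(\<Sum>t \<in> T. ?r \<omega> t)\<^sup>2 = (\<Sum>t \<in> T. \<Sum>t' \<in> T. ?r \<omega> t * ?r \<omega> t')" for \<omega>
    by (simp add: power2_eq_square sum_product)
  have pos: "0 \<le> resid_bound"
    by (simp add: resid_bound_def)
  show "integrable M (\<lambda>\<omega>. (\<Sum>t \<in> T. ?r \<omega> t)\<^sup>2)"
    unfolding sq using T1 by (intro Bochner_Integration.integrable_sum resid_at_product) auto
  have "expectation (\<lambda>\<omega>. (\<Sum>t \<in> T. ?r \<omega> t)\<^sup>2) = (\<Sum>t \<in> T. expectation (\<lambda>\<omega>. \<Sum>t' \<in> T. ?r \<omega> t * ?r \<omega> t'))"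
    unfolding sq by (intro Bochner_Integration.integral_sum Bochner_Integration.integrable_sum
        resid_at_product(1) T1)
  also have "\<dots> = (\<Sum>t \<in> T. \<Sum>t' \<in> T. expectation (\<lambda>\<omega>. ?r \<omega> t * ?r \<omega> t'))"
    by (intro sum.cong refl Bochner_Integration.integral_sum resid_at_product(1) T1)
  also have "\<dots> = (\<Sum>t \<in> T. \<Sum>t' \<in> {t' \<in> T. overlap t t'}. expectation (\<lambda>\<omega>. ?r \<omega> t * ?r \<omega> t'))"
    using T1 fin by (intro sum.cong refl sum.mono_neutral_right) (auto simp: resid_at_orthogonal)
  also have "\<dots> \<le> (\<Sum>t \<in> T. \<Sum>t' \<in> {t' \<in> T. overlap t t'}. resid_bound)"
    using T1 by (intro sum_mono resid_at_product) auto
  also have "\<dots> \<le> (\<Sum>t \<in> T. 27 * real n * resid_bound)"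
  proof (intro sum_mono)
    fix t
    have "card {t' \<in> T. overlap t t'} \<le> card {t' \<in> triples {1..n}. overlap t t'}"
      using T finite_triples[of "{1..n}"] by (intro card_mono) auto
    also have "\<dots> \<le> 27 * n"
      by (rule card_overlap_le)
    finally have "real (card {t' \<in> T. overlap t t'}) \<le> 27 * real n"
      by (metis of_nat_le_iff of_nat_mult of_nat_numeral)
    then show "(\<Sum>t' \<in> {t' \<in> T. overlap t t'}. resid_bound) \<le> 27 * real n * resid_bound"
      using pos by (simp add: mult_right_mono)
  qed
  also have "\<dots> = 27 * resid_bound * real (card T) * real n"
    by simp
  finally show "expectation (\<lambda>\<omega>. (\<Sum>t \<in> T. ?r \<omega> t)\<^sup>2) \<le> 27 * resid_bound * real (card T) * real n" .
qed

end

subsection \<open>Limit theorems for i.i.d. samples\<close>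

lemma (in prob_space) prob_ge_le:
  fixes u :: "'a \<Rightarrow> real"
  assumes "integrable M u" "\<And>\<omega>. 0 \<le> u \<omega>" "0 < c"
  shows "prob {\<omega> \<in> space M. c \<le> u \<omega>} \<le> expectation u / c"
  using assms by (intro integral_Markov_inequality_measure[OF _ sets.top]) auto

context iid_sample
begin

lemma measure_D_UNIV [simp]: "measure D UNIV = 1"
  using D.prob_space by simp

lemma expectation_product:
  fixes \<phi> :: "real \<Rightarrow> real"
  assumes [measurable]: "\<phi> \<in> borel_measurable borel" and \<phi>: "integrable D \<phi>" "(\<integral>x. \<phi> x \<partial>D) = 0"
    and ij: "i \<ge> 1" "j \<ge> 1" "i \<noteq> j"
  shows "expectation (\<lambda>\<omega>. \<phi> (X i \<omega>) * \<phi> (X j \<omega>)) = 0"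
    and "integrable M (\<lambda>\<omega>. \<phi> (X i \<omega>) * \<phi> (X j \<omega>))"
proof -
  have "indep_var borel (X i) borel (X j)"
    using pair_law[OF ij] ij by (simp add: indep_var_distribution_eq law)
  then have "indep_var borel (\<phi> \<circ> X i) borel (\<phi> \<circ> X j)"
    by (rule indep_var_compose) measurable
  then have ind: "indep_var borel (\<lambda>\<omega>. \<phi> (X i \<omega>)) borel (\<lambda>\<omega>. \<phi> (X j \<omega>))"
    by (simp add: comp_def)
  have int: "integrable M (\<lambda>\<omega>. \<phi> (X i \<omega>))" "integrable M (\<lambda>\<omega>. \<phi> (X j \<omega>))"
    using ij \<phi> by (simp_all add: integrable_X_iff)
  show "expectation (\<lambda>\<omega>. \<phi> (X i \<omega>) * \<phi> (X j \<omega>)) = 0"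
    using indep_var_lebesgue_integral[OF ind int] ij \<phi> by (simp add: expectation_X)
  show "integrable M (\<lambda>\<omega>. \<phi> (X i \<omega>) * \<phi> (X j \<omega>))"
    by (rule indep_var_integrable[OF ind int])
qed

lemma sum_square_centered:
  fixes \<phi> :: "real \<Rightarrow> real"
  assumes [measurable]: "\<phi> \<in> borel_measurable borel"
    and \<phi>: "integrable D (\<lambda>x. (\<phi> x)\<^sup>2)" "(\<integral>x. \<phi> x \<partial>D) = 0"
  shows "integrable M (\<lambda>\<omega>. (\<Sum>i = 1..n. \<phi> (X i \<omega>))\<^sup>2)"
    and "expectation (\<lambda>\<omega>. (\<Sum>i = 1..n. \<phi> (X i \<omega>))\<^sup>2) = n * (\<integral>x. (\<phi> x)\<^sup>2 \<partial>D)"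
proof -
  have i: "integrable D \<phi>"
    using \<phi>(1) by (rule D.square_integrable_imp_integrable[rotated]) simp
  have sq: "(\<Sum>i = 1..n. \<phi> (X i \<omega>))\<^sup>2 = (\<Sum>i = 1..n. \<Sum>j = 1..n. \<phi> (X i \<omega>) * \<phi> (X j \<omega>))" for \<omega>
    by (simp add: power2_eq_square sum_product)
  have int: "integrable M (\<lambda>\<omega>. \<phi> (X i \<omega>) * \<phi> (X j \<omega>))" if "i \<in> {1..n}" "j \<in> {1..n}" for i j
  proof (cases "i = j")
    case True
    then show ?thesis
      using that \<phi>(1) integrable_X_iff[of i "\<lambda>x. (\<phi> x)\<^sup>2"] by (simp add: power2_eq_square)
  next
    case False
    then show ?thesis
      using that i \<phi>(2) by (intro expectation_product) auto
  qed
  show "integrable M (\<lambda>\<omega>. (\<Sum>i = 1..n. \<phi> (X i \<omega>))\<^sup>2)"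
    unfolding sq by (intro Bochner_Integration.integrable_sum int)
  have "expectation (\<lambda>\<omega>. (\<Sum>i = 1..n. \<phi> (X i \<omega>))\<^sup>2)
      = (\<Sum>i = 1..n. expectation (\<lambda>\<omega>. \<Sum>j = 1..n. \<phi> (X i \<omega>) * \<phi> (X j \<omega>)))"
    unfolding sq by (intro Bochner_Integration.integral_sum Bochner_Integration.integrable_sum int)
  also have "\<dots> = (\<Sum>i = 1..n. \<Sum>j = 1..n. expectation (\<lambda>\<omega>. \<phi> (X i \<omega>) * \<phi> (X j \<omega>)))"
    by (intro sum.cong refl Bochner_Integration.integral_sum int)
  also have "\<dots> = (\<Sum>i = 1..n. \<Sum>j = 1..n. if i = j then (\<integral>x. (\<phi> x)\<^sup>2 \<partial>D) else 0)"
  proof (intro sum.cong refl)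
    fix i j assume ij: "i \<in> {1..n}" "j \<in> {1..n}"
    show "expectation (\<lambda>\<omega>. \<phi> (X i \<omega>) * \<phi> (X j \<omega>)) = (if i = j then (\<integral>x. (\<phi> x)\<^sup>2 \<partial>D) else 0)"
      using ij i \<phi>(2) expectation_product(1)[of \<phi> i j] expectation_X[of i "\<lambda>x. (\<phi> x)\<^sup>2"]
      by (auto simp: power2_eq_square)
  qed
  also have "\<dots> = n * (\<integral>x. (\<phi> x)\<^sup>2 \<partial>D)"
    by simp
  finally show "expectation (\<lambda>\<omega>. (\<Sum>i = 1..n. \<phi> (X i \<omega>))\<^sup>2) = n * (\<integral>x. (\<phi> x)\<^sup>2 \<partial>D)" .
qed

text \<open>Dominated convergence, as the integrand is eventually 0 at each point. Applied to a
  function it gives the truncation level of the weak law, applied to a square it controls the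
  maximum.\<close>

lemma tail_integral_tendsto_0:
  fixes \<phi> :: "real \<Rightarrow> real"
  assumes [measurable]: "\<phi> \<in> borel_measurable borel" and \<phi>: "integrable D \<phi>" and c: "0 < c"
  shows "(\<lambda>n. \<integral>x. (if c * real n \<le> \<bar>\<phi> x\<bar> then \<bar>\<phi> x\<bar> else 0) \<partial>D) \<longlonglongrightarrow> 0"
proof -
  have "(\<lambda>n. \<integral>x. (if c * real n \<le> \<bar>\<phi> x\<bar> then \<bar>\<phi> x\<bar> else 0) \<partial>D) \<longlonglongrightarrow> (\<integral>x. 0 \<partial>D)"
  proof (rule integral_dominated_convergence[where w = "\<lambda>x. \<bar>\<phi> x\<bar>"])
    have "(\<lambda>n. if c * real n \<le> \<bar>\<phi> x\<bar> then \<bar>\<phi> x\<bar> else 0) \<longlonglongrightarrow> 0" for x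
    proof (rule tendsto_eventually)
      have "filterlim (\<lambda>n. c * real n) at_top sequentially"
        using c by (intro filterlim_tendsto_pos_mult_at_top[OF tendsto_const] filterlim_real_sequentially)
      then have "\<forall>\<^sub>F n in sequentially. \<bar>\<phi> x\<bar> < c * real n"
        by (simp add: filterlim_at_top_dense)
      then show "\<forall>\<^sub>F n in sequentially. (if c * real n \<le> \<bar>\<phi> x\<bar> then \<bar>\<phi> x\<bar> else 0) = 0"
        by eventually_elim simp
    qed
    then show "AE x in D. (\<lambda>n. if c * real n \<le> \<bar>\<phi> x\<bar> then \<bar>\<phi> x\<bar> else 0) \<longlonglongrightarrow> 0"
      by simp
  qed (use \<phi> in auto)
  then show ?thesis
    by simp
qed

text \<open>By truncation, since only a first moment is available.\<close>

lemma weak_law: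
  fixes \<phi> :: "real \<Rightarrow> real"
  assumes [measurable]: "\<phi> \<in> borel_measurable borel" and \<phi>: "integrable D \<phi>" and e: "0 < e"
  shows "(\<lambda>n. prob {\<omega> \<in> space M. e \<le> \<bar>(\<Sum>i = 1..n. \<phi> (X i \<omega>)) / n - (\<integral>x. \<phi> x \<partial>D)\<bar>}) \<longlonglongrightarrow> 0"
proof (rule LIMSEQ_I)
  fix d :: real assume d: "0 < d"
  \<comment> \<open>The bound \<open>e / 3\<close> limits the change of mean caused by truncation;
    \<open>e * d / 6\<close> makes Markov's bound for the discarded part at most
    \<open>d / 2\<close>.\<close>
  define \<epsilon> where "\<epsilon> = min (e / 3) (e * d / 6)"
  have "0 < \<epsilon>"
    using e d by (simp add: \<epsilon>_def)
  moreover have "(\<lambda>n. \<integral>x. (if 1 * real n \<le> \<bar>\<phi> x\<bar> then \<bar>\<phi> x\<bar> else 0) \<partial>D) \<longlonglongrightarrow> 0"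
    by (rule tail_integral_tendsto_0) (use \<phi> in auto)
  ultimately have "\<forall>\<^sub>F n in sequentially. (\<integral>x. (if 1 * real n \<le> \<bar>\<phi> x\<bar> then \<bar>\<phi> x\<bar> else 0) \<partial>D) < \<epsilon>"
    by (rule order_tendstoD(2)[rotated])
  then obtain k :: nat where k: "(\<integral>x. (if real k \<le> \<bar>\<phi> x\<bar> then \<bar>\<phi> x\<bar> else 0) \<partial>D) < \<epsilon>"
    by (auto simp: eventually_sequentially)
  define \<psi> where "\<psi> x = (if real k \<le> \<bar>\<phi> x\<bar> then 0 else \<phi> x)" for x
  define \<xi> where "\<xi> x = \<psi> x - (\<integral>x. \<psi> x \<partial>D)" for x
  have [measurable]: "\<psi> \<in> borel_measurable borel" "\<xi> \<in> borel_measurable borel"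
    unfolding \<psi>_def \<xi>_def by measurable
  have \<psi>k: "\<bar>\<psi> x\<bar> \<le> k" for x
    by (simp add: \<psi>_def)
  have int\<psi>: "integrable D \<psi>"
    by (rule D.integrable_const_bound[where B = k]) (use \<psi>k in auto)
  have "\<bar>(\<integral>x. \<psi> x \<partial>D)\<bar> \<le> (\<integral>x. real k \<partial>D)"
    using int\<psi> \<psi>k by (intro order_trans[OF integral_abs_bound] integral_mono) auto
  then have \<xi>k: "\<bar>\<xi> x\<bar> \<le> 2 * k" for x
    using \<psi>k[of x] by (simp add: \<xi>_def)
  have \<xi>k2: "(\<xi> x)\<^sup>2 \<le> (2 * k)\<^sup>2" for x
    using power_mono[OF \<xi>k[of x] abs_ge_zero, of 2] by simp
  have int\<xi>: "integrable D (\<lambda>x. (\<xi> x)\<^sup>2)"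
    by (rule D.integrable_const_bound[where B = "(2 * k)\<^sup>2"]) (use \<xi>k2 in auto)
  have \<xi>0: "(\<integral>x. \<xi> x \<partial>D) = 0"
    using int\<psi> by (simp add: \<xi>_def D.prob_space)
  have "(\<integral>x. (\<xi> x)\<^sup>2 \<partial>D) \<le> (\<integral>x. (2 * real k)\<^sup>2 \<partial>D)"
    using int\<xi> \<xi>k2 by (intro integral_mono) auto
  then have var: "(\<integral>x. (\<xi> x)\<^sup>2 \<partial>D) \<le> (2 * k)\<^sup>2"
    by (simp add: D.prob_space)
  have eq: "\<bar>\<phi> x - \<psi> x\<bar> = (if real k \<le> \<bar>\<phi> x\<bar> then \<bar>\<phi> x\<bar> else 0)" for x
    by (simp add: \<psi>_def)
  have tail: "(\<integral>x. \<bar>\<phi> x - \<psi> x\<bar> \<partial>D) < \<epsilon>"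
    using k by (simp only: eq)
  have "\<bar>(\<integral>x. \<phi> x \<partial>D) - (\<integral>x. \<psi> x \<partial>D)\<bar> \<le> (\<integral>x. \<bar>\<phi> x - \<psi> x\<bar> \<partial>D)"
    using \<phi> int\<psi> integral_abs_bound[of D "\<lambda>x. \<phi> x - \<psi> x"] by simp
  then have diff: "\<bar>(\<integral>x. \<phi> x \<partial>D) - (\<integral>x. \<psi> x \<partial>D)\<bar> < e / 3"
    using tail by (simp add: \<epsilon>_def)
  let ?A = "\<lambda>n. {\<omega> \<in> space M. (e / 3)\<^sup>2 \<le> ((\<Sum>i = 1..n. \<xi> (X i \<omega>)) / n)\<^sup>2}"
  let ?B = "\<lambda>n. {\<omega> \<in> space M. e / 3 \<le> (\<Sum>i = 1..n. \<bar>\<phi> (X i \<omega>) - \<psi> (X i \<omega>)\<bar>) / n}"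
  let ?C = "\<lambda>n. {\<omega> \<in> space M. e \<le> \<bar>(\<Sum>i = 1..n. \<phi> (X i \<omega>)) / n - (\<integral>x. \<phi> x \<partial>D)\<bar>}"
  have meas: "?A n \<in> sets M" "?B n \<in> sets M" for n
    by measurable
  \<comment> \<open>The deviation consists of the centred truncated mean, the mean of the discarded
    parts and a deterministic shift below \<open>e / 3\<close>; if it reaches \<open>e\<close>, one
    of the first two reaches \<open>e / 3\<close>.\<close>
  have sub: "?C n \<subseteq> ?A n \<union> ?B n" if n: "n \<ge> 1" for n
  proof
    fix \<omega> assume \<omega>: "\<omega> \<in> ?C n"
    define a where "a = (\<Sum>i = 1..n. \<xi> (X i \<omega>)) / n"
    define b where "b = (\<Sum>i = 1..n. \<bar>\<phi> (X i \<omega>) - \<psi> (X i \<omega>)\<bar>) / n"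
    have 1: "(\<Sum>i = 1..n. \<phi> (X i \<omega>)) / n = a + (\<integral>x. \<psi> x \<partial>D) + (\<Sum>i = 1..n. \<phi> (X i \<omega>) - \<psi> (X i \<omega>)) / n"
      using n by (simp add: a_def \<xi>_def sum_subtractf diff_divide_distrib)
    have 2: "\<bar>(\<Sum>i = 1..n. \<phi> (X i \<omega>) - \<psi> (X i \<omega>)) / n\<bar> \<le> b"
      by (simp add: b_def abs_divide divide_right_mono)
    have key: "c \<le> \<bar>a\<bar> \<or> c \<le> b"
      if "S = a + q + r" "\<bar>r\<bar> \<le> b" "\<bar>p - q\<bar> < c" "3 * c \<le> \<bar>S - p\<bar>" for c p q r S :: real
      using that by linarith
    have "e / 3 \<le> \<bar>a\<bar> \<or> e / 3 \<le> b"
      by (rule key[OF 1 2 diff]) (use \<omega> in simp)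
    then show "\<omega> \<in> ?A n \<union> ?B n"
    proof
      assume "e / 3 \<le> \<bar>a\<bar>"
      then have "(e / 3)\<^sup>2 \<le> a\<^sup>2"
        using e power_mono[of "e / 3" "\<bar>a\<bar>" 2] by simp
      then show ?thesis
        using \<omega> by (simp add: a_def)
    qed (use \<omega> in \<open>simp add: b_def\<close>)
  qed
  have CAB: "prob (?C n) \<le> prob (?A n) + prob (?B n)" if n: "n \<ge> 1" for n
    by (rule order_trans[OF finite_measure_mono[OF sub[OF n]] measure_Un_le]) (use meas in auto)
  have A: "prob (?A n) \<le> 36 * real k ^ 2 / (e\<^sup>2 * n)" if n: "n \<ge> 1" for n
  proof -
    have "prob (?A n) \<le> expectation (\<lambda>\<omega>. ((\<Sum>i = 1..n. \<xi> (X i \<omega>)) / n)\<^sup>2) / (e / 3)\<^sup>2"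
      using e sum_square_centered(1)[OF _ int\<xi> \<xi>0, of n]
      by (intro prob_ge_le) (auto simp: power_divide)
    also have "\<dots> = (\<integral>x. (\<xi> x)\<^sup>2 \<partial>D) * 9 / (e\<^sup>2 * n)"
      using n sum_square_centered(2)[OF _ int\<xi> \<xi>0, of n] by (simp add: power_divide power2_eq_square)
    also have "\<dots> \<le> (2 * k)\<^sup>2 * 9 / (e\<^sup>2 * n)"
      using var by (intro divide_right_mono mult_right_mono) auto
    finally show ?thesis
      by (simp add: power_mult_distrib)
  qed
  have B: "prob (?B n) \<le> d / 2" if n: "n \<ge> 1" for n
  proof -
    have int: "integrable D (\<lambda>x. \<bar>\<phi> x - \<psi> x\<bar>)"
      using \<phi> int\<psi> by simp
    have int': "integrable M (\<lambda>\<omega>. \<bar>\<phi> (X i \<omega>) - \<psi> (X i \<omega>)\<bar>)" if "i \<in> {1..n}" for i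
      using that int integrable_X_iff[of i "\<lambda>x. \<bar>\<phi> x - \<psi> x\<bar>"] by simp
    have "prob (?B n) \<le> expectation (\<lambda>\<omega>. (\<Sum>i = 1..n. \<bar>\<phi> (X i \<omega>) - \<psi> (X i \<omega>)\<bar>) / n) / (e / 3)"
      using e int' by (intro prob_ge_le integrable_divide Bochner_Integration.integrable_sum) (auto intro!: sum_nonneg divide_nonneg_nonneg)
    also have "expectation (\<lambda>\<omega>. (\<Sum>i = 1..n. \<bar>\<phi> (X i \<omega>) - \<psi> (X i \<omega>)\<bar>) / n)
        = (\<Sum>i = 1..n. expectation (\<lambda>\<omega>. \<bar>\<phi> (X i \<omega>) - \<psi> (X i \<omega>)\<bar>)) / n"
      using int' by (simp add: Bochner_Integration.integral_sum)
    also have "\<dots> = (\<Sum>i = 1..n. (\<integral>x. \<bar>\<phi> x - \<psi> x\<bar> \<partial>D)) / n"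
      using expectation_X[of _ "\<lambda>x. \<bar>\<phi> x - \<psi> x\<bar>"] by (intro arg_cong2[where f = "(/)"] sum.cong refl) simp
    also have "\<dots> = (\<integral>x. \<bar>\<phi> x - \<psi> x\<bar> \<partial>D)"
      using n by simp
    also have "\<dots> / (e / 3) \<le> (e * d / 6) / (e / 3)"
      using tail e by (intro divide_right_mono) (auto simp: \<epsilon>_def)
    also have "\<dots> = d / 2"
      using e by simp
    finally show ?thesis .
  qed
  have "(\<lambda>n. 36 * real k ^ 2 / (e\<^sup>2 * real n)) \<longlonglongrightarrow> 0"
    using lim_const_over_n[of "36 * real k ^ 2 / e\<^sup>2"] by (simp add: divide_divide_eq_left)
  then have "\<forall>\<^sub>F n in sequentially. 36 * real k ^ 2 / (e\<^sup>2 * real n) < d / 2"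
    using d by (intro order_tendstoD(2)) auto
  then have "\<forall>\<^sub>F n in sequentially. prob (?C n) < d"
    using eventually_ge_at_top[of 1]
  proof eventually_elim
    case (elim n)
    show ?case
      using CAB[OF elim(2)] A[OF elim(2)] B[OF elim(2)] elim(1) by linarith
  qed
  then show "\<exists>no. \<forall>n\<ge>no. norm (prob (?C n) - 0) < d"
    by (simp add: eventually_sequentially)
qed

text \<open>Union bound with Markov's inequality applied to the tail part of the square: each of the
  \<open>n\<close> terms is at most \<open>\<tau> n / (e\<^sup>2 * n)\<close>, and
  \<open>\<tau> n\<close> tends to 0. Markov's inequality for the full square would only give
  boundedness.\<close>

lemma max_negligible:
  fixes \<phi> :: "real \<Rightarrow> real"
  assumes [measurable]: "\<phi> \<in> borel_measurable borel" and \<phi>: "integrable D (\<lambda>x. (\<phi> x)\<^sup>2)" and e: "0 < e"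
  shows "(\<lambda>n. prob {\<omega> \<in> space M. \<exists>i \<in> {1..n}. e * sqrt n \<le> \<bar>\<phi> (X i \<omega>)\<bar>}) \<longlonglongrightarrow> 0"
proof -
  define \<tau> where "\<tau> n = (\<integral>x. (if e\<^sup>2 * real n \<le> \<bar>(\<phi> x)\<^sup>2\<bar> then \<bar>(\<phi> x)\<^sup>2\<bar> else 0) \<partial>D)" for n
  have \<tau>: "\<tau> \<longlonglongrightarrow> 0"
    unfolding \<tau>_def[abs_def] by (rule tail_integral_tendsto_0) (use \<phi> e in auto)
  have le: "prob {\<omega> \<in> space M. \<exists>i \<in> {1..n}. e * sqrt n \<le> \<bar>\<phi> (X i \<omega>)\<bar>} \<le> \<tau> n / e\<^sup>2" if n: "n \<ge> 1" for n
  proof -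
    let ?u = "\<lambda>x. if e\<^sup>2 * real n \<le> \<bar>(\<phi> x)\<^sup>2\<bar> then \<bar>(\<phi> x)\<^sup>2\<bar> else 0"
    have pos: "0 < e\<^sup>2 * real n"
      using e n by simp
    have int: "integrable D ?u"
      by (rule Bochner_Integration.integrable_bound[OF \<phi>]) auto
    have "{\<omega> \<in> space M. \<exists>i \<in> {1..n}. e * sqrt n \<le> \<bar>\<phi> (X i \<omega>)\<bar>}
        \<subseteq> (\<Union>i \<in> {1..n}. {\<omega> \<in> space M. e\<^sup>2 * n \<le> ?u (X i \<omega>)})"
    proof safe
      fix \<omega> i assume \<omega>: "\<omega> \<in> space M" "i \<in> {1..n}" "e * sqrt n \<le> \<bar>\<phi> (X i \<omega>)\<bar>"
      then have "(e * sqrt n)\<^sup>2 \<le> \<bar>\<phi> (X i \<omega>)\<bar>\<^sup>2"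
        using e by (intro power_mono) auto
      then have "e\<^sup>2 * n \<le> ?u (X i \<omega>)"
        by (simp add: power_mult_distrib)
      then show "\<omega> \<in> (\<Union>i \<in> {1..n}. {\<omega> \<in> space M. e\<^sup>2 * n \<le> ?u (X i \<omega>)})"
        using \<omega> by blast
    qed
    moreover have meas: "{\<omega> \<in> space M. e\<^sup>2 * n \<le> ?u (X i \<omega>)} \<in> sets M" if "i \<in> {1..n}" for i
    proof -
      have [measurable]: "X i \<in> borel_measurable M"
        using that by auto
      show ?thesis
        by measurable
    qed
    ultimately have "prob {\<omega> \<in> space M. \<exists>i \<in> {1..n}. e * sqrt n \<le> \<bar>\<phi> (X i \<omega>)\<bar>}
        \<le> prob (\<Union>i \<in> {1..n}. {\<omega> \<in> space M. e\<^sup>2 * n \<le> ?u (X i \<omega>)})"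
      by (intro finite_measure_mono sets.finite_UN finite_atLeastAtMost)
    also have "\<dots> \<le> (\<Sum>i = 1..n. prob {\<omega> \<in> space M. e\<^sup>2 * n \<le> ?u (X i \<omega>)})"
      by (intro measure_UNION_le finite_atLeastAtMost meas)
    also have "\<dots> \<le> (\<Sum>i = 1..n. \<tau> n / (e\<^sup>2 * n))"
    proof (rule sum_mono)
      fix i assume i: "i \<in> {1..n}"
      have "prob {\<omega> \<in> space M. e\<^sup>2 * n \<le> ?u (X i \<omega>)} \<le> expectation (\<lambda>\<omega>. ?u (X i \<omega>)) / (e\<^sup>2 * n)"
        using i int pos integrable_X_iff[of i ?u] by (intro prob_ge_le) auto
      also have "expectation (\<lambda>\<omega>. ?u (X i \<omega>)) = \<tau> n"
        using i expectation_X[of i ?u] by (simp add: \<tau>_def)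
      finally show "prob {\<omega> \<in> space M. e\<^sup>2 * n \<le> ?u (X i \<omega>)} \<le> \<tau> n / (e\<^sup>2 * n)" .
    qed
    also have "\<dots> = \<tau> n / e\<^sup>2"
      using n by simp
    finally show ?thesis .
  qed
  have lim: "(\<lambda>n. \<tau> n / e\<^sup>2) \<longlonglongrightarrow> 0"
    using tendsto_divide[OF \<tau> tendsto_const[of "e\<^sup>2"]] e by simp
  have "\<forall>\<^sub>F n in sequentially.
      prob {\<omega> \<in> space M. \<exists>i \<in> {1..n}. e * sqrt n \<le> \<bar>\<phi> (X i \<omega>)\<bar>} \<le> \<tau> n / e\<^sup>2"
    using eventually_ge_at_top[of 1] by eventually_elim (rule le)
  then show ?thesis
    by (rule tendsto_sandwich[OF always_eventually _ tendsto_const lim, rotated]) simp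
qed

lemma clt:
  fixes \<phi> :: "real \<Rightarrow> real"
  assumes [measurable]: "\<phi> \<in> borel_measurable borel"
    and \<phi>: "integrable D (\<lambda>x. (\<phi> x)\<^sup>2)" "(\<integral>x. \<phi> x \<partial>D) = 0" and \<sigma>: "0 < \<sigma>" "\<sigma>\<^sup>2 = (\<integral>x. (\<phi> x)\<^sup>2 \<partial>D)"
  shows "weak_conv_m (\<lambda>n. distr M borel (\<lambda>\<omega>. (\<Sum>i = 1..n. \<phi> (X i \<omega>)) / (sqrt n * \<sigma>))) std_normal_distribution"
proof -
  \<comment> \<open>The sample is indexed from 1 and the central limit theorem from 0; regrouping
    into the blocks \<open>{Suc j}\<close> performs the shift.\<close>
  have "indep_vars (\<lambda>j. PiM {Suc j} (\<lambda>_. borel)) (\<lambda>j \<omega>. restrict (\<lambda>i. X i \<omega>) {Suc j}) (UNIV :: nat set)"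
    by (rule indep_vars_restrict[OF indep]) (auto simp: disjoint_family_on_def)
  then have "indep_vars (\<lambda>_. borel) (\<lambda>j \<omega>. \<phi> (restrict (\<lambda>i. X i \<omega>) {Suc j} (Suc j))) UNIV"
    by (rule indep_vars_compose2) measurable
  then have ind: "indep_vars (\<lambda>_. borel) (\<lambda>j \<omega>. \<phi> (X (Suc j) \<omega>)) UNIV"
    by simp
  have distr: "distr M borel (\<lambda>\<omega>. \<phi> (X (Suc j) \<omega>)) = distr D borel \<phi>" for j
    using law[of "Suc j"] distr_distr[of \<phi> borel borel "X (Suc j)" M] by (simp add: comp_def)
  have "weak_conv_m (\<lambda>n. distr M borel (\<lambda>\<omega>. (\<Sum>i<n. \<phi> (X (Suc i) \<omega>)) / sqrt (n * \<sigma>\<^sup>2))) std_normal_distribution"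
  proof (rule central_limit_theorem_zero_mean[OF ind _ \<sigma>(1) _ _ distr])
    show mean: "expectation (\<lambda>\<omega>. \<phi> (X (Suc n) \<omega>)) = 0" for n
      using \<phi> by (simp add: expectation_X)
    show "integrable M (\<lambda>\<omega>. (\<phi> (X (Suc n) \<omega>))\<^sup>2)" for n
      using \<phi> integrable_X_iff[of "Suc n" "\<lambda>x. (\<phi> x)\<^sup>2"] by simp
    show "variance (\<lambda>\<omega>. \<phi> (X (Suc n) \<omega>)) = \<sigma>\<^sup>2" for n
      using mean[of n] \<sigma> expectation_X[of "Suc n" "\<lambda>x. (\<phi> x)\<^sup>2"] by simp
  qed
  moreover have "(\<Sum>i<n. \<phi> (X (Suc i) \<omega>)) / sqrt (n * \<sigma>\<^sup>2) = (\<Sum>i = 1..n. \<phi> (X i \<omega>)) / (sqrt n * \<sigma>)" for n \<omega>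
    using \<sigma>(1) sum.atLeast1_atMost_eq[of "\<lambda>i. \<phi> (X i \<omega>)" n] by (simp add: real_sqrt_mult)
  ultimately show ?thesis
    by simp
qed

end

subsection \<open>Linearisation of the pseudo-values\<close>

lemma (in prob_space) negligible_of_expectation:
  fixes u :: "nat \<Rightarrow> 'a \<Rightarrow> real"
  assumes u: "\<And>n. n \<ge> k \<Longrightarrow> integrable M (u n)" "\<And>n. n \<ge> k \<Longrightarrow> expectation (u n) \<le> C / n"
    and nonneg: "\<And>n \<omega>. 0 \<le> u n \<omega>" and e: "0 < e"
  shows "(\<lambda>n. prob {\<omega> \<in> space M. e \<le> u n \<omega>}) \<longlonglongrightarrow> 0"
proof -
  have lim: "(\<lambda>n. C / real n / e) \<longlonglongrightarrow> 0"
    using tendsto_divide[OF lim_const_over_n[of C] tendsto_const[of e]] e by simp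
  have le: "prob {\<omega> \<in> space M. e \<le> u n \<omega>} \<le> C / n / e" if "n \<ge> k" for n
  proof -
    have "prob {\<omega> \<in> space M. e \<le> u n \<omega>} \<le> expectation (u n) / e"
      by (rule prob_ge_le[OF u(1)[OF that] nonneg e])
    also have "\<dots> \<le> C / n / e"
      using u(2)[OF that] e by (intro divide_right_mono) auto
    finally show ?thesis .
  qed
  have "\<forall>\<^sub>F n in sequentially. prob {\<omega> \<in> space M. e \<le> u n \<omega>} \<le> C / n / e"
    using eventually_ge_at_top[of k] by eventually_elim (rule le)
  then show ?thesis
    by (rule tendsto_sandwich[OF always_eventually _ tendsto_const lim, rotated]) simp
qed

context symmetric_sample
begin

definition resid_sum :: "nat \<Rightarrow> 'a \<Rightarrow> real" where
  "resid_sum n \<omega> = (\<Sum>t \<in> triples {1..n}. resid_at (\<lambda>i. X i \<omega>) t)"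

definition resid_sum_at :: "nat \<Rightarrow> nat \<Rightarrow> 'a \<Rightarrow> real" where
  "resid_sum_at n i \<omega> = (\<Sum>t \<in> {t \<in> triples {1..n}. i \<in> indices t}. resid_at (\<lambda>i. X i \<omega>) t)"

lemma resid_bound_nonneg: "0 \<le> resid_bound"
  by (simp add: resid_bound_def)

text \<open>There are at most \<open>n^3\<close> triples, and each overlaps at most
  \<open>27 * n\<close> others. Among triples through a fixed index, treated next, the count
  \<open>n^2\<close> replaces \<open>n^3\<close>.\<close>

lemma resid_sum_square_le:
  assumes n: "n \<ge> 2"
  shows "integrable M (\<lambda>\<omega>. (resid_sum n \<omega>)\<^sup>2)"
    and "expectation (\<lambda>\<omega>. (resid_sum n \<omega>)\<^sup>2) \<le> 27 * resid_bound * real n ^ 4"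
proof -
  show "integrable M (\<lambda>\<omega>. (resid_sum n \<omega>)\<^sup>2)"
    unfolding resid_sum_def by (rule resid_sum_square[where n = n]) simp
  have "real (card (triples {1..n})) \<le> real n ^ 3"
  proof -
    have "real n * (real n - 1) * (real n - 2) / 6 \<le> real n * real n * real n / 1"
      using n by (intro frac_le mult_mono mult_nonneg_nonneg) auto
    then show ?thesis
      by (simp add: card_triples choose_three power3_eq_cube)
  qed
  then have "27 * resid_bound * real (card (triples {1..n})) * real n \<le> 27 * resid_bound * real n ^ 3 * real n"
    using resid_bound_nonneg by (intro mult_right_mono mult_left_mono) auto
  moreover have "expectation (\<lambda>\<omega>. (resid_sum n \<omega>)\<^sup>2) \<le> 27 * resid_bound * real (card (triples {1..n})) * real n"
    unfolding resid_sum_def by (rule resid_sum_square[where n = n]) simp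
  ultimately show "expectation (\<lambda>\<omega>. (resid_sum n \<omega>)\<^sup>2) \<le> 27 * resid_bound * real n ^ 4"
    by (simp add: power_numeral_reduce mult.assoc)
qed

lemma resid_sum_at_square_le:
  assumes n: "n \<ge> 2" and i: "i \<in> {1..n}"
  shows "integrable M (\<lambda>\<omega>. (resid_sum_at n i \<omega>)\<^sup>2)"
    and "expectation (\<lambda>\<omega>. (resid_sum_at n i \<omega>)\<^sup>2) \<le> 27 * resid_bound * real n ^ 3"
proof -
  let ?T = "{t \<in> triples {1..n}. i \<in> indices t}"
  show "integrable M (\<lambda>\<omega>. (resid_sum_at n i \<omega>)\<^sup>2)"
    unfolding resid_sum_at_def by (rule resid_sum_square[where n = n]) auto
  have "real (card ?T) \<le> real n ^ 2"
  proof -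
    have "(real n - 1) * (real n - 2) / 2 \<le> real n * real n / 1"
      using n by (intro frac_le mult_mono mult_nonneg_nonneg) auto
    then show ?thesis
      using i by (simp add: card_triples_containing power2_eq_square)
  qed
  then have "27 * resid_bound * real (card ?T) * real n \<le> 27 * resid_bound * real n ^ 2 * real n"
    using resid_bound_nonneg by (intro mult_right_mono mult_left_mono) auto
  moreover have "expectation (\<lambda>\<omega>. (resid_sum_at n i \<omega>)\<^sup>2) \<le> 27 * resid_bound * real (card ?T) * real n"
    unfolding resid_sum_at_def by (rule resid_sum_square[where n = n]) auto
  ultimately show "expectation (\<lambda>\<omega>. (resid_sum_at n i \<omega>)\<^sup>2) \<le> 27 * resid_bound * real n ^ 3"
    by (simp add: power_numeral_reduce mult.assoc)
qed

definition pv :: "nat \<Rightarrow> nat \<Rightarrow> 'a \<Rightarrow> real" where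
  "pv n i \<omega> = pseudo_value n (\<lambda>i. X i \<omega>) i"

lemma pv_measurable [measurable]: "pv n i \<in> borel_measurable M"
proof -
  have U: "(\<lambda>\<omega>. U_stat A (\<lambda>i. X i \<omega>)) \<in> borel_measurable M" if "A \<subseteq> {1..}" for A
  proof -
    have "(\<lambda>\<omega>. case t of (i, j, k) \<Rightarrow> kern (X i \<omega>) (X j \<omega>) (X k \<omega>)) \<in> borel_measurable M"
      if "t \<in> triples A" for t
    proof -
      obtain i j k where t: "t = (i, j, k)" by (cases t)
      then have [measurable]: "X i \<in> borel_measurable M" "X j \<in> borel_measurable M" "X k \<in> borel_measurable M"
        using that \<open>A \<subseteq> {1..}\<close> by (auto simp: triples_def)
      show ?thesis
        unfolding t by simp measurable
    qed
    then show ?thesis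
      unfolding U_stat_def triples_def[symmetric] by (intro borel_measurable_divide borel_measurable_sum) auto
  qed
  show ?thesis
    unfolding pv_def[abs_def] pseudo_value_def
    by (intro borel_measurable_diff borel_measurable_times borel_measurable_const U) auto
qed

lemma pv_eq:
  assumes n: "n \<ge> 4" and i: "i \<in> {1..n}"
  shows "pv n i \<omega> - 3 * proj (X i \<omega>) = 6 * resid_sum_at n i \<omega> / ((real n - 2) * (real n - 3))
      - 12 * resid_sum n \<omega> / ((real n - 1) * (real n - 2) * (real n - 3))"
  using pseudo_value_decomp[OF assms, of "\<lambda>i. X i \<omega>" "\<lambda>l. proj (X l \<omega>)"]
  unfolding pv_def resid_sum_at_def resid_sum_def resid_at_def by simp

lemma mean_pv_eq:
  assumes n: "n \<ge> 4"
  shows "(\<Sum>i = 1..n. pv n i \<omega>) / n - (\<Sum>i = 1..n. 3 * proj (X i \<omega>)) / n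
      = 6 * resid_sum n \<omega> / (real n * (real n - 1) * (real n - 2))"
  using mean_pseudo_value[OF n, of "\<lambda>i. X i \<omega>"] n
    U_stat_decomp[of "{1..n}" "\<lambda>i. X i \<omega>" "\<lambda>l. proj (X l \<omega>)"]
  unfolding pv_def resid_sum_def resid_at_def sum_distrib_left[symmetric] by simp

lemma remainder_square_le:
  assumes n: "n \<ge> 6" and i: "i \<in> {1..n}"
  shows "integrable M (\<lambda>\<omega>. (pv n i \<omega> - 3 * proj (X i \<omega>))\<^sup>2)"
    and "expectation (\<lambda>\<omega>. (pv n i \<omega> - 3 * proj (X i \<omega>))\<^sup>2) \<le> 528768 * resid_bound / n"
proof -
  define N where "N = real n"
  have N: "N \<ge> 6"
    using n by (simp add: N_def)
  let ?b = "\<lambda>\<omega>. 1152 * (resid_sum_at n i \<omega>)\<^sup>2 / N ^ 4 + 18432 * (resid_sum n \<omega>)\<^sup>2 / N ^ 6"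
  have le: "(pv n i \<omega> - 3 * proj (X i \<omega>))\<^sup>2 \<le> ?b \<omega>" for \<omega>
  proof -
    \<comment> \<open>For \<open>N \<ge> 6\<close> each of the factors \<open>N - 1\<close>,
      \<open>N - 2\<close>, \<open>N - 3\<close> is at least \<open>N / 2\<close>. Together with
      \<open>(x - y)^2 \<le> 2 * x^2 + 2 * y^2\<close> this gives the constants
      \<open>1152 = 2 * (6 * 4)^2\<close> and \<open>18432 = 2 * (12 * 8)^2\<close>.\<close>
    have P: "N\<^sup>2 / 4 \<le> (N - 2) * (N - 3)"
      using N mult_mono[of "N / 2" "N - 2" "N / 2" "N - 3"] by (simp add: power2_eq_square)
    then have Q: "N ^ 3 / 8 \<le> (N - 1) * (N - 2) * (N - 3)"
      using N mult_mono[of "N / 2" "N - 1" "N\<^sup>2 / 4" "(N - 2) * (N - 3)"]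
      by (simp add: power2_eq_square power3_eq_cube mult.assoc)
    have p: "(6 * a / q)\<^sup>2 \<le> (6 * a / r)\<^sup>2" if "0 < r" "r \<le> q" for a q r :: real
      using that unfolding power_divide by (intro divide_left_mono power_mono) (auto intro!: mult_pos_pos)
    have two: "(x - y)\<^sup>2 \<le> 2 * x\<^sup>2 + 2 * y\<^sup>2" for x y :: real
      using sum_squares_ge_zero[of "x + y" 0] by (simp add: power2_eq_square algebra_simps)
    have "(pv n i \<omega> - 3 * proj (X i \<omega>))\<^sup>2
        \<le> 2 * (6 * resid_sum_at n i \<omega> / ((N - 2) * (N - 3)))\<^sup>2
          + 2 * (6 * (2 * resid_sum n \<omega>) / ((N - 1) * (N - 2) * (N - 3)))\<^sup>2"
      using n i two by (subst pv_eq) (auto simp: N_def)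
    also have "\<dots> \<le> 2 * (6 * resid_sum_at n i \<omega> / (N\<^sup>2 / 4))\<^sup>2 + 2 * (6 * (2 * resid_sum n \<omega>) / (N ^ 3 / 8))\<^sup>2"
      using N P Q by (intro add_mono mult_left_mono p) auto
    also have "\<dots> = ?b \<omega>"
      using N by (simp add: power_divide power_mult_distrib flip: power_mult)
    finally show ?thesis .
  qed
  have n2: "n \<ge> 2"
    using n by simp
  note K = resid_sum_square_le[OF n2] and Ki = resid_sum_at_square_le[OF n2 i]
  have b: "integrable M ?b"
    using K Ki by simp
  have i1: "1 \<le> i"
    using i by simp
  have [measurable]: "X i \<in> borel_measurable M"
    using i1 by simp
  show int: "integrable M (\<lambda>\<omega>. (pv n i \<omega> - 3 * proj (X i \<omega>))\<^sup>2)"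
  proof (rule Bochner_Integration.integrable_bound[OF b])
    show "AE \<omega> in M. norm ((pv n i \<omega> - 3 * proj (X i \<omega>))\<^sup>2) \<le> norm (?b \<omega>)"
      unfolding real_norm_def abs_power2 by (intro AE_I2 order_trans[OF le abs_ge_self])
  qed measurable
  have "expectation (\<lambda>\<omega>. (pv n i \<omega> - 3 * proj (X i \<omega>))\<^sup>2) \<le> expectation ?b"
    by (rule integral_mono[OF int b le])
  also have "\<dots> = 1152 * expectation (\<lambda>\<omega>. (resid_sum_at n i \<omega>)\<^sup>2) / N ^ 4
      + 18432 * expectation (\<lambda>\<omega>. (resid_sum n \<omega>)\<^sup>2) / N ^ 6"
    using K Ki by simp
  also have "\<dots> \<le> 1152 * (27 * resid_bound * N ^ 3) / N ^ 4 + 18432 * (27 * resid_bound * N ^ 4) / N ^ 6"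
    using K Ki N unfolding N_def by (intro add_mono divide_right_mono mult_left_mono) auto
  also have "\<dots> = 31104 * resid_bound / N + 497664 * resid_bound / (N * N)"
    using N by (simp add: power_numeral_reduce)
  also have "\<dots> \<le> 31104 * resid_bound / N + 497664 * resid_bound / (N * 1)"
    using N resid_bound_nonneg by (intro add_mono divide_left_mono mult_left_mono) auto
  also have "\<dots> = 528768 * resid_bound / n"
    by (simp add: N_def add_divide_distrib[symmetric])
  finally show "expectation (\<lambda>\<omega>. (pv n i \<omega> - 3 * proj (X i \<omega>))\<^sup>2) \<le> 528768 * resid_bound / n" .
qed

lemma remainder_mean_square_negligible:
  assumes "0 < e"
  shows "(\<lambda>n. prob {\<omega> \<in> space M. e \<le> (\<Sum>i = 1..n. (pv n i \<omega> - 3 * proj (X i \<omega>))\<^sup>2) / n}) \<longlonglongrightarrow> 0"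
proof (rule negligible_of_expectation[where k = 6 and C = "528768 * resid_bound", OF _ _ _ assms])
  fix n :: nat assume n: "n \<ge> 6"
  note r = remainder_square_le[OF n]
  show "integrable M (\<lambda>\<omega>. (\<Sum>i = 1..n. (pv n i \<omega> - 3 * proj (X i \<omega>))\<^sup>2) / n)"
    by (intro integrable_divide Bochner_Integration.integrable_sum r)
  have "expectation (\<lambda>\<omega>. (\<Sum>i = 1..n. (pv n i \<omega> - 3 * proj (X i \<omega>))\<^sup>2) / n)
      = expectation (\<lambda>\<omega>. \<Sum>i = 1..n. (pv n i \<omega> - 3 * proj (X i \<omega>))\<^sup>2) / n"
    by simp
  also have "expectation (\<lambda>\<omega>. \<Sum>i = 1..n. (pv n i \<omega> - 3 * proj (X i \<omega>))\<^sup>2)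
      = (\<Sum>i = 1..n. expectation (\<lambda>\<omega>. (pv n i \<omega> - 3 * proj (X i \<omega>))\<^sup>2))"
    by (rule Bochner_Integration.integral_sum) (rule r)
  also have "\<dots> / n \<le> (\<Sum>i = 1..n. 528768 * resid_bound / n) / n"
    by (intro divide_right_mono sum_mono r) auto
  also have "\<dots> = 528768 * resid_bound / n"
    using n by simp
  finally show "expectation (\<lambda>\<omega>. (\<Sum>i = 1..n. (pv n i \<omega> - 3 * proj (X i \<omega>))\<^sup>2) / n) \<le> 528768 * resid_bound / n" .
qed (auto intro!: divide_nonneg_nonneg sum_nonneg)

text \<open>The factor \<open>n\<close> is the squared scaling of the central limit theorem. It is
  affordable because the residual sum has second moment of order \<open>n^4\<close> against a
  squared normaliser of order \<open>n^6\<close>; the constant is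
  \<open>15552 = 36 * 16 * 27\<close>.\<close>

lemma mean_remainder_negligible:
  assumes "0 < e"
  shows "(\<lambda>n. prob {\<omega> \<in> space M. e \<le> n * ((\<Sum>i = 1..n. pv n i \<omega>) / n - (\<Sum>i = 1..n. 3 * proj (X i \<omega>)) / n)\<^sup>2}) \<longlonglongrightarrow> 0"
proof (rule negligible_of_expectation[where k = 6 and C = "15552 * resid_bound", OF _ _ _ assms])
  fix n :: nat assume n: "n \<ge> 6"
  define N where "N = real n"
  have N: "N \<ge> 6"
    using n by (simp add: N_def)
  have n2: "n \<ge> 2"
    using n by simp
  let ?Q = "N * (N - 1) * (N - 2)"
  have Q: "N ^ 3 / 4 \<le> ?Q"
  proof -
    have "N\<^sup>2 / 4 \<le> (N - 1) * (N - 2)"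
      using N mult_mono[of "N / 2" "N - 1" "N / 2" "N - 2"] by (simp add: power2_eq_square)
    then have "N * (N\<^sup>2 / 4) \<le> N * ((N - 1) * (N - 2))"
      using N by (intro mult_left_mono) auto
    then show ?thesis
      by (simp add: power2_eq_square power3_eq_cube mult.assoc)
  qed
  have eq: "n * ((\<Sum>i = 1..n. pv n i \<omega>) / n - (\<Sum>i = 1..n. 3 * proj (X i \<omega>)) / n)\<^sup>2
      = N * 36 / ?Q\<^sup>2 * (resid_sum n \<omega>)\<^sup>2" for \<omega>
    using n by (subst mean_pv_eq) (auto simp: N_def power_divide power_mult_distrib)
  show "integrable M (\<lambda>\<omega>. n * ((\<Sum>i = 1..n. pv n i \<omega>) / n - (\<Sum>i = 1..n. 3 * proj (X i \<omega>)) / n)\<^sup>2)"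
    unfolding eq by (intro integrable_mult_right resid_sum_square_le n2)
  have "expectation (\<lambda>\<omega>. n * ((\<Sum>i = 1..n. pv n i \<omega>) / n - (\<Sum>i = 1..n. 3 * proj (X i \<omega>)) / n)\<^sup>2)
      = N * 36 / ?Q\<^sup>2 * expectation (\<lambda>\<omega>. (resid_sum n \<omega>)\<^sup>2)"
    unfolding eq by simp
  also have "\<dots> \<le> N * 36 / ?Q\<^sup>2 * (27 * resid_bound * N ^ 4)"
    using N resid_sum_square_le(2)[OF n2] by (intro mult_left_mono) (auto simp: N_def)
  also have "\<dots> \<le> N * 36 / (N ^ 3 / 4)\<^sup>2 * (27 * resid_bound * N ^ 4)"
    using N Q resid_bound_nonneg
    by (intro mult_right_mono divide_left_mono power_mono mult_pos_pos zero_less_power) auto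
  also have "\<dots> = 15552 * resid_bound / n"
    using N by (simp add: N_def power_divide power_numeral_reduce)
  finally show "expectation (\<lambda>\<omega>. n * ((\<Sum>i = 1..n. pv n i \<omega>) / n - (\<Sum>i = 1..n. 3 * proj (X i \<omega>)) / n)\<^sup>2)
      \<le> 15552 * resid_bound / n" .
qed simp

end

subsection \<open>Nondegeneracy\<close>

text \<open>The point \<open>x\<close> moved into the interval spanned by \<open>y\<close> and
  \<open>z\<close>, which is the median of the three numbers.\<close>

definition clamp_between :: "real \<Rightarrow> real \<Rightarrow> real \<Rightarrow> real" where
  "clamp_between y z x = max (min y z) (min (max y z) x)"

text \<open>Maximum, median and minimum add up to \<open>x + y + z\<close>, so the midrange is half
  of the sum without the median. In this form the dependence on \<open>x\<close> is visible: slope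
  \<open>-1/3\<close> between \<open>y\<close> and \<open>z\<close>, slope \<open>1/6\<close>
  outside.\<close>

lemma kern_eq_median: "kern x y z = (x + y + z) / 6 - clamp_between y z x / 2"
proof -
  define a b where ab: "a = min y z" "b = max y z"
  have sum: "a + b = y + z" and le: "a \<le> b"
    by (auto simp: ab)
  have "max x b + min x a + max a (min b x) = x + a + b"
    using le by (simp add: max_def min_def)
  then have "max x b + min x a = x + y + z - max a (min b x)"
    using sum by simp
  moreover have "kern x y z = (max x b + min x a) / 2 - (x + y + z) / 3"
    unfolding kern_def ab[symmetric] by (simp add: field_simps)
  ultimately show ?thesis
    unfolding clamp_between_def ab[symmetric] by (simp add: field_simps)
qed

text \<open>The clamped value never decreases in \<open>x\<close>, and it grows by the full
  \<open>x' - x\<close> when \<open>y\<close> and \<open>z\<close> enclose both points. An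
  inequality suffices, so partly enclosed steps need not be computed.\<close>

lemma kern_increment:
  assumes x: "x \<le> x'"
  shows "kern x' y z - kern x y z
    \<le> (x' - x) / 6 - (x' - x) / 2 * (indicator ({..x} \<times> {x'<..}) (y, z) + indicator ({x'<..} \<times> {..x}) (y, z))"
proof -
  have "(x' - x) * (indicator ({..x} \<times> {x'<..}) (y, z) + indicator ({x'<..} \<times> {..x}) (y, z))
      \<le> clamp_between y z x' - clamp_between y z x"
    using x unfolding clamp_between_def by (auto simp: indicator_def max_def min_def)
  then show ?thesis
    unfolding kern_eq_median by (simp add: field_simps)
qed

context symmetric_sample
begin

sublocale D: real_distribution D
  by unfold_locales simp

lemma isCont_cdf_D: "isCont (cdf D) x"
  using no_atoms by (simp add: D.isCont_cdf)

lemma measure_DD_Times: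
  assumes "A \<in> sets borel" "B \<in> sets borel"
  shows "measure (D \<Otimes>\<^sub>M D) (A \<times> B) = measure D A * measure D B"
  using assms D.emeasure_pair_measure_Times[of A D B] by (simp add: measure_def enn2real_mult)

text \<open>Integrated form of the slope formula: each of the two rectangles in
  \<open>kern_increment\<close> has probability \<open>F x * (1 - F x')\<close>. Working with
  increments avoids differentiating under the integral.\<close>

lemma proj_increment:
  assumes x: "x \<le> x'"
  shows "proj x' - proj x \<le> (x' - x) * (1 / 6 - cdf D x * (1 - cdf D x'))"
proof -
  let ?S = "{..x} \<times> {x'<..}" and ?T = "{x'<..} \<times> {..x}"
  have [measurable]: "?S \<in> sets (D \<Otimes>\<^sub>M D)" "?T \<in> sets (D \<Otimes>\<^sub>M D)"
    by auto
  have [simp]: "integrable (D \<Otimes>\<^sub>M D) (indicator ?S :: _ \<Rightarrow> real)" "integrable (D \<Otimes>\<^sub>M D) (indicator ?T :: _ \<Rightarrow> real)"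
    by (auto simp: less_top[symmetric])
  have int: "integrable (D \<Otimes>\<^sub>M D) (\<lambda>p. (x' - x) / 6 - (x' - x) / 2 * (indicator ?S p + indicator ?T p))"
    by simp
  have up: "measure D {x'<..} = 1 - cdf D x'"
  proof -
    have "{x'<..} = space D - {..x'}"
      by auto
    then show ?thesis
      using D.prob_compl[of "{..x'}"] by (simp add: cdf_def)
  qed
  have "proj x' - proj x = (\<integral>p. kern x' (fst p) (snd p) - kern x (fst p) (snd p) \<partial>(D \<Otimes>\<^sub>M D))"
    unfolding proj_def by (simp add: integrable_kern)
  also have "\<dots> \<le> (\<integral>p. (x' - x) / 6 - (x' - x) / 2 * (indicator ?S p + indicator ?T p) \<partial>(D \<Otimes>\<^sub>M D))"
  proof (rule integral_mono[OF _ int])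
    show "kern x' (fst p) (snd p) - kern x (fst p) (snd p) \<le> (x' - x) / 6 - (x' - x) / 2 * (indicator ?S p + indicator ?T p)" for p
      using kern_increment[OF x, of "fst p" "snd p"] by simp
  qed (intro Bochner_Integration.integrable_diff integrable_kern)
  also have "\<dots> = (x' - x) / 6 - (x' - x) / 2 * (measure (D \<Otimes>\<^sub>M D) ?S + measure (D \<Otimes>\<^sub>M D) ?T)"
    using DD.P.prob_space by simp
  also have "\<dots> = (x' - x) * (1 / 6 - cdf D x * (1 - cdf D x'))"
    by (simp add: measure_DD_Times up cdf_def field_simps)
  finally show ?thesis .
qed

lemma integrable_proj_square: "integrable D (\<lambda>x. (proj x)\<^sup>2)"
proof (rule Bochner_Integration.integrable_bound)
  show "integrable D (\<lambda>x. 2 * x\<^sup>2 + 8 * mean_abs\<^sup>2)"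
    using square_integrable by simp
  have "(proj x)\<^sup>2 \<le> 2 * x\<^sup>2 + 8 * mean_abs\<^sup>2" for x
  proof -
    have "(proj x)\<^sup>2 \<le> (\<bar>x\<bar> + 2 * mean_abs)\<^sup>2"
      using power_mono[OF proj_bound[of x] abs_ge_zero, of 2] by simp
    also have "\<dots> \<le> 2 * x\<^sup>2 + 8 * mean_abs\<^sup>2"
      using sum_squares_bound[of "\<bar>x\<bar>" "2 * mean_abs"] by (simp add: power2_sum power_mult_distrib)
    finally show ?thesis .
  qed
  then show "AE x in D. norm ((proj x)\<^sup>2) \<le> norm (2 * x\<^sup>2 + 8 * mean_abs\<^sup>2)"
    unfolding real_norm_def abs_power2 by (intro AE_I2 order_trans[OF _ abs_ge_self])
qed simp

text \<open>The slope of \<open>proj\<close> is \<open>1/6 - F (1 - F)\<close>, which is negative where \<open>F\<close> is near \<open>1/2\<close>.\<close>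

lemma proj_nondegenerate: "0 < (\<integral>x. (proj x)\<^sup>2 \<partial>D)"
proof (rule ccontr)
  assume "\<not> 0 < (\<integral>x. (proj x)\<^sup>2 \<partial>D)"
  moreover have "0 \<le> (\<integral>x. (proj x)\<^sup>2 \<partial>D)"
    by simp
  ultimately have "(\<integral>x. (proj x)\<^sup>2 \<partial>D) = 0"
    by linarith
  then have "AE x in D. (proj x)\<^sup>2 = 0"
    using integral_nonneg_eq_0_iff_AE[OF integrable_proj_square] by simp
  then have AE0: "AE x in D. proj x = 0"
    by simp
  have "\<forall>\<^sub>F x in at_bot. cdf D x < 9 / 20"
    using D.cdf_lim_at_bot by (rule order_tendstoD) simp
  then obtain l where l: "cdf D l \<le> 9 / 20"
    by (metis eventually_happens' less_imp_le trivial_limit_at_bot_linorder)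
  have "\<forall>\<^sub>F x in at_top. 11 / 20 < cdf D x"
    using D.cdf_lim_at_top_prob by (rule order_tendstoD) simp
  then obtain u where u: "11 / 20 \<le> cdf D u"
    by (metis eventually_happens' less_imp_le trivial_limit_at_top_linorder)
  have lu: "l \<le> u"
  proof (rule ccontr)
    assume "\<not> l \<le> u"
    then have "cdf D u \<le> cdf D l"
      by (intro D.cdf_nondecreasing) simp
    then show False
      using l u by simp
  qed
  \<comment> \<open>Absence of atoms makes the distribution function continuous, so both levels are
    attained. They are close enough to \<open>1/2\<close>: between them
    \<open>F x * (1 - F x')\<close> is at least \<open>81/400\<close>, which exceeds
    \<open>1/6\<close>.\<close>
  obtain a where a: "cdf D a = 9 / 20"
    using IVT[of "cdf D" l "9 / 20" u] l u lu isCont_cdf_D by auto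
  obtain b where b: "cdf D b = 11 / 20"
    using IVT[of "cdf D" l "11 / 20" u] l u lu isCont_cdf_D by auto
  have ab: "a < b"
  proof (rule ccontr)
    assume "\<not> a < b"
    then have "cdf D b \<le> cdf D a"
      by (intro D.cdf_nondecreasing) simp
    then show False
      using a b by simp
  qed
  have dec: "proj x' < proj x" if xx': "a < x" "x < x'" "x' \<le> b" for x x'
  proof -
    have "9 / 20 \<le> cdf D x" "9 / 20 \<le> 1 - cdf D x'"
      using D.cdf_nondecreasing[of a x] D.cdf_nondecreasing[of x' b] a b xx' by simp_all
    then have "9 / 20 * (9 / 20) \<le> cdf D x * (1 - cdf D x')"
      by (intro mult_mono) auto
    then have "(x' - x) * (1 / 6 - cdf D x * (1 - cdf D x')) < 0"
      using xx' by (intro mult_pos_neg) auto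
    then show ?thesis
      using proj_increment[of x x'] xx' by simp
  qed
  \<comment> \<open>A strictly decreasing function has at most one zero here. The interval has mass
    \<open>1/10\<close> and would lie almost surely in the zero set, hence in a single point, which
    has no mass.\<close>
  have sub: "{x \<in> {a<..b}. proj x = 0} \<subseteq> {SOME x. x \<in> {a<..b} \<and> proj x = 0}"
  proof
    fix x assume x: "x \<in> {x \<in> {a<..b}. proj x = 0}"
    define y where "y = (SOME x. x \<in> {a<..b} \<and> proj x = 0)"
    have y: "y \<in> {a<..b} \<and> proj y = 0"
      unfolding y_def by (rule someI[of _ x]) (use x in simp)
    have "x = y"
      using dec[of x y] dec[of y x] x y by (cases x y rule: linorder_cases) auto
    then show "x \<in> {SOME x. x \<in> {a<..b} \<and> proj x = 0}"
      by (simp add: y_def)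
  qed
  have "measure D {a<..b} = 1 / 10"
    using D.cdf_diff_eq[OF ab] a b by simp
  moreover have "measure D {a<..b} = measure D {x \<in> {a<..b}. proj x = 0}"
    using AE0 by (intro D.finite_measure_eq_AE) auto
  moreover have "measure D {x \<in> {a<..b}. proj x = 0} \<le> measure D {SOME x. x \<in> {a<..b} \<and> proj x = 0}"
    by (rule D.finite_measure_mono[OF sub]) simp
  ultimately show False
    using no_atoms by simp
qed

end

subsection \<open>The limit law\<close>

text \<open>In this lemma \<open>g\<close> plays the role of the linearised pseudo-values and \<open>v\<close> that of the
  actual ones; \<open>d\<close> measures how far the sample is from its limit.\<close>

lemma neg2_log_el_ratio_perturbed:
  fixes g v :: "nat \<Rightarrow> real" and s d t :: real
  assumes n: "n \<ge> 1" and s: "0 < s" and d: "0 < d" "d \<le> 1 / 100" and t: "0 \<le> t"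
    and mean: "n * ((\<Sum>i = 1..n. v i) / n - (\<Sum>i = 1..n. g i) / n)\<^sup>2 < d\<^sup>2 * s\<^sup>2"
    and close: "(\<Sum>i = 1..n. (v i - g i)\<^sup>2) / n < d ^ 4 * s\<^sup>2"
    and var: "\<bar>(\<Sum>i = 1..n. (g i)\<^sup>2) / n - s\<^sup>2\<bar> < d * s\<^sup>2"
    and max: "\<And>i. i \<in> {1..n} \<Longrightarrow> \<bar>g i\<bar> < d\<^sup>2 * s * sqrt n"
    and z: "z = (\<Sum>i = 1..n. g i) / (sqrt n * s)" "\<bar>z\<bar> \<le> 1 / d"
  shows "neg2_log (el_ratio n v) \<le> ereal t \<Longrightarrow> \<bar>z\<bar> \<le> sqrt (t * (1 + 3 * d) / (1 - 80 * d)) + d"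
    and "\<bar>z\<bar> \<le> sqrt (t * (1 - 3 * d) / (1 + 80 * d)) - d \<Longrightarrow> neg2_log (el_ratio n v) \<le> ereal t"
proof -
  define N where "N = real n"
  have N: "N \<ge> 1"
    using n by (simp add: N_def)
  define V where "V = (\<Sum>i = 1..n. v i) / n"
  define S where "S = (\<Sum>i = 1..n. (v i)\<^sup>2) / n"
  define q where "q = (\<Sum>i = 1..n. (g i)\<^sup>2) / n"
  define \<rho> where "\<rho> = (\<Sum>i = 1..n. (v i - g i)\<^sup>2) / n"
  define y where "y = sqrt N * V / s"
  have \<rho>: "0 \<le> \<rho>" "\<rho> < d ^ 4 * s\<^sup>2"
    using close by (auto simp: \<rho>_def intro!: divide_nonneg_nonneg sum_nonneg)
  have q: "\<bar>q - s\<^sup>2\<bar> < d * s\<^sup>2"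
    using var by (simp add: q_def)
  have s2: "0 < s\<^sup>2"
    using s by simp

  have "\<bar>S - q\<bar> \<le> d * q + (1 + 1 / d) * \<rho>"
  proof -
    have "\<bar>(v i)\<^sup>2 - (g i)\<^sup>2\<bar> \<le> d * (g i)\<^sup>2 + (1 + 1 / d) * (v i - g i)\<^sup>2" for i
    proof -
      define r where "r = v i - g i"
      \<comment> \<open>Young's inequality with weight \<open>d\<close>. The price
        \<open>1 / d\<close> on the squared error is paid by the factor \<open>d ^ 4\<close> in
        \<open>close\<close>.\<close>
      have "2 * \<bar>g i * r\<bar> \<le> d * (g i)\<^sup>2 + r\<^sup>2 / d"
      proof -
        have "0 \<le> (d * \<bar>g i\<bar> - \<bar>r\<bar>)\<^sup>2 / d"
          using d by simp
        also have "\<dots> = d * (g i)\<^sup>2 + r\<^sup>2 / d - 2 * \<bar>g i * r\<bar>"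
          using d by (simp add: power2_diff power2_eq_square abs_mult field_simps)
        finally show ?thesis by simp
      qed
      moreover have "(v i)\<^sup>2 - (g i)\<^sup>2 = 2 * (g i * r) + r\<^sup>2"
        by (simp add: r_def power2_eq_square algebra_simps)
      moreover have "(1 + 1 / d) * r\<^sup>2 = r\<^sup>2 + r\<^sup>2 / d"
        by (simp add: algebra_simps)
      ultimately show ?thesis
        unfolding r_def[symmetric] using abs_triangle_ineq[of "2 * (g i * r)" "r\<^sup>2"] by (simp add: abs_mult)
    qed
    then have "\<bar>\<Sum>i = 1..n. (v i)\<^sup>2 - (g i)\<^sup>2\<bar> \<le> (\<Sum>i = 1..n. d * (g i)\<^sup>2 + (1 + 1 / d) * (v i - g i)\<^sup>2)"
      by (intro order_trans[OF sum_abs] sum_mono)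
    also have "\<dots> = d * (\<Sum>i = 1..n. (g i)\<^sup>2) + (1 + 1 / d) * (\<Sum>i = 1..n. (v i - g i)\<^sup>2)"
      by (simp add: sum.distrib sum_distrib_left)
    finally have "\<bar>\<Sum>i = 1..n. (v i)\<^sup>2 - (g i)\<^sup>2\<bar> / N
        \<le> (d * (\<Sum>i = 1..n. (g i)\<^sup>2) + (1 + 1 / d) * (\<Sum>i = 1..n. (v i - g i)\<^sup>2)) / N"
      using N by (intro divide_right_mono) auto
    moreover have "S - q = (\<Sum>i = 1..n. (v i)\<^sup>2 - (g i)\<^sup>2) / N"
      by (simp add: S_def q_def N_def sum_subtractf diff_divide_distrib)
    ultimately show ?thesis
      using N by (simp add: abs_divide q_def \<rho>_def N_def add_divide_distrib)
  qed
  also have "\<dots> \<le> 2 * d * s\<^sup>2"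
  proof -
    have "d * q \<le> d * ((1 + d) * s\<^sup>2)"
      using q d by (intro mult_left_mono) (auto simp: algebra_simps)
    moreover have "(1 + 1 / d) * \<rho> \<le> (2 / d) * (d ^ 4 * s\<^sup>2)"
      using \<rho> d by (intro mult_mono) (auto simp: field_simps)
    moreover have "(2 / d) * (d ^ 4 * s\<^sup>2) = 2 * d\<^sup>2 * (d * s\<^sup>2)"
      using d by (simp add: power_numeral_reduce power2_eq_square)
    moreover have "(1 + d) * (d * s\<^sup>2) + 2 * d\<^sup>2 * (d * s\<^sup>2) \<le> 2 * (d * s\<^sup>2)"
    proof -
      have "d\<^sup>2 \<le> d"
        using d by (simp add: power2_eq_square mult_left_le)
      then have "(1 + d) + 2 * d\<^sup>2 \<le> 2"
        using d by simp
      then have "((1 + d) + 2 * d\<^sup>2) * (d * s\<^sup>2) \<le> 2 * (d * s\<^sup>2)"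
        using d s2 by (intro mult_right_mono) auto
      then show ?thesis
        by (simp only: distrib_right)
    qed
    ultimately show ?thesis
      by (simp add: mult.assoc mult.left_commute)
  qed
  finally have S: "\<bar>S - s\<^sup>2\<bar> \<le> 3 * d * s\<^sup>2"
    using q by (simp add: abs_le_iff abs_less_iff)
  have ds: "3 * d * s\<^sup>2 \<le> 3 / 100 * s\<^sup>2"
    using d s2 by (intro mult_right_mono) auto
  have S_pos: "0 < S"
    using S ds s2 by linarith
  have S_up: "S \<le> (1 + 3 * d) * s\<^sup>2" and S_low: "(1 - 3 * d) * s\<^sup>2 \<le> S"
    using S by (simp_all add: abs_le_iff algebra_simps)

  have yz: "\<bar>y - z\<bar> \<le> d"
  proof -
    have "y - z = sqrt N * ((\<Sum>i = 1..n. v i) / n - (\<Sum>i = 1..n. g i) / n) / s"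
    proof -
      have "sqrt N * (a / N) = a * (sqrt N / N)" for a
        by simp
      moreover have "sqrt N / N = inverse (sqrt N)"
        using N by (intro sqrt_divide_self_eq) simp
      ultimately have "a / (sqrt N * s) = sqrt N * (a / N) / s" for a
        by (simp add: divide_inverse)
      then show ?thesis
        by (simp add: y_def z V_def N_def[symmetric] right_diff_distrib diff_divide_distrib)
    qed
    then have "(y - z)\<^sup>2 = N * ((\<Sum>i = 1..n. v i) / n - (\<Sum>i = 1..n. g i) / n)\<^sup>2 / s\<^sup>2"
      using N by (simp add: power_divide power_mult_distrib)
    also have "\<dots> \<le> d\<^sup>2"
      using mean s2 by (simp add: N_def pos_divide_le_eq less_imp_le)
    finally show ?thesis
      using d by (simp add: abs_le_square_iff[symmetric])
  qed
  have y_le: "\<bar>y\<bar> \<le> 2 / d"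
  proof -
    have "d \<le> 1 / d"
      using d by (simp add: pos_le_divide_eq mult_le_one)
    moreover have "\<bar>y\<bar> \<le> \<bar>z\<bar> + d"
      using yz by linarith
    ultimately have "\<bar>y\<bar> \<le> 1 / d + 1 / d"
      using z(2) by linarith
    then show ?thesis
      by simp
  qed

  \<comment> \<open>A single squared error is at most \<open>n\<close> times the mean square error.
    This crude bound suffices, since a maximum below a small multiple of \<open>sqrt n\<close> is
    all that is required.\<close>
  have b: "\<bar>v i\<bar> \<le> 2 * d\<^sup>2 * s * sqrt N" if i: "i \<in> {1..n}" for i
  proof -
    have "(v i - g i)\<^sup>2 \<le> N * \<rho>"
      using i n member_le_sum[of i "{1..n}" "\<lambda>i. (v i - g i)\<^sup>2"] by (simp add: \<rho>_def N_def)
    also have "\<dots> \<le> N * (d ^ 4 * s\<^sup>2)"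
      using \<rho> N by (intro mult_left_mono) auto
    also have "\<dots> = (d\<^sup>2 * s * sqrt N)\<^sup>2"
      using N by (simp add: power_mult_distrib flip: power_mult)
    finally have "\<bar>v i - g i\<bar> \<le> d\<^sup>2 * s * sqrt N"
      using s N by (simp add: abs_le_square_iff[symmetric])
    then show ?thesis
      using max[OF i] by (simp add: N_def)
  qed
  \<comment> \<open>This explains the powers of \<open>d\<close> in the hypotheses:
    \<open>\<bar>z\<bar> \<le> 1 / d\<close> allows \<open>y\<close> to be as large as
    \<open>2 / d\<close>, and one factor of the \<open>d\<^sup>2\<close> in the bound for the
    maximum compensates it. The result is \<open>e = 8 * d\<close>, whence the constant 80 in the
    conclusions; \<open>d \<le> 1 / 100\<close> keeps \<open>e\<close> below
    \<open>1 / 10\<close>.\<close>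
  have small: "\<bar>V\<bar> * (2 * d\<^sup>2 * s * sqrt N) \<le> 8 * d * S"
  proof -
    have "\<bar>V\<bar> * (2 * d\<^sup>2 * s * sqrt N) = 2 * d\<^sup>2 * s\<^sup>2 * \<bar>y\<bar>"
      using s N by (simp add: y_def abs_mult abs_divide power2_eq_square)
    also have "\<dots> \<le> 2 * d\<^sup>2 * s\<^sup>2 * (2 / d)"
      using y_le by (intro mult_left_mono) auto
    also have "\<dots> = 4 * d * s\<^sup>2"
      using d by (simp add: power2_eq_square)
    also have "\<dots> \<le> 4 * d * (2 * S)"
    proof (intro mult_left_mono)
      show "s\<^sup>2 \<le> 2 * S"
        using S ds s2 by linarith
    qed (use d in auto)
    finally show ?thesis
      by simp
  qed
  have W: "real n * V\<^sup>2 / S = y\<^sup>2 * s\<^sup>2 / S"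
    using s N by (simp add: y_def power_divide power_mult_distrib N_def)
  note bounds = neg2_log_el_ratio_bounds[OF n V_def S_def S_pos b small]
  have e: "8 * d \<le> 1 / 10"
    using d by simp
  have low: "ereal ((1 - 80 * d) * (y\<^sup>2 * s\<^sup>2 / S)) \<le> neg2_log (el_ratio n v)"
    using bounds(1)[OF _ e] by (simp add: W)
  have up: "neg2_log (el_ratio n v) \<le> ereal ((1 + 80 * d) * (y\<^sup>2 * s\<^sup>2 / S))"
    using bounds(2)[OF _ e] by (simp add: W)
  have d80: "0 < 1 - 80 * d" "0 < 1 + 80 * d" "0 < 1 - 3 * d" "0 < 1 + 3 * d"
    using d by simp_all

  show "\<bar>z\<bar> \<le> sqrt (t * (1 + 3 * d) / (1 - 80 * d)) + d" if "neg2_log (el_ratio n v) \<le> ereal t"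
  proof -
    have "(1 - 80 * d) * (y\<^sup>2 * s\<^sup>2 / S) \<le> t"
      using order_trans[OF low that] by simp
    moreover have "y\<^sup>2 / (1 + 3 * d) \<le> y\<^sup>2 * s\<^sup>2 / S"
    proof -
      have "y\<^sup>2 * s\<^sup>2 / ((1 + 3 * d) * s\<^sup>2) \<le> y\<^sup>2 * s\<^sup>2 / S"
        using S_up S_pos d80 s2 by (intro divide_left_mono) auto
      then show ?thesis
        using s by simp
    qed
    then have "(1 - 80 * d) * (y\<^sup>2 / (1 + 3 * d)) \<le> (1 - 80 * d) * (y\<^sup>2 * s\<^sup>2 / S)"
      using d80 by (intro mult_left_mono) auto
    ultimately have "(1 - 80 * d) * (y\<^sup>2 / (1 + 3 * d)) \<le> t"
      by linarith
    then have "y\<^sup>2 \<le> t * (1 + 3 * d) / (1 - 80 * d)"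
      using d80 by (simp add: pos_le_divide_eq pos_divide_le_eq mult.commute)
    then have "\<bar>y\<bar> \<le> sqrt (t * (1 + 3 * d) / (1 - 80 * d))"
      by (intro real_le_rsqrt) simp
    then show ?thesis
      using yz by linarith
  qed
  show "neg2_log (el_ratio n v) \<le> ereal t" if "\<bar>z\<bar> \<le> sqrt (t * (1 - 3 * d) / (1 + 80 * d)) - d"
  proof -
    have "\<bar>y\<bar> \<le> sqrt (t * (1 - 3 * d) / (1 + 80 * d))"
      using that yz by linarith
    then have "\<bar>y\<bar>\<^sup>2 \<le> (sqrt (t * (1 - 3 * d) / (1 + 80 * d)))\<^sup>2"
      by (intro power_mono) auto
    then have y2: "y\<^sup>2 \<le> t * (1 - 3 * d) / (1 + 80 * d)"
      using t d80 by simp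
    have "y\<^sup>2 * s\<^sup>2 / S \<le> y\<^sup>2 * s\<^sup>2 / ((1 - 3 * d) * s\<^sup>2)"
      using S_low S_pos d80 s2 by (intro divide_left_mono) auto
    also have "\<dots> = y\<^sup>2 / (1 - 3 * d)"
      using s by simp
    also have "\<dots> \<le> t / (1 + 80 * d)"
      using y2 d80 by (simp add: pos_divide_le_eq)
    finally have "(1 + 80 * d) * (y\<^sup>2 * s\<^sup>2 / S) \<le> t"
      using d80 by (simp add: pos_le_divide_eq mult.commute)
    then show ?thesis
      using up by (meson ereal_less_eq(3) order_trans)
  qed
qed

text \<open>Written with the distribution function, which makes continuity on the whole line
  immediate and admits negative radii.\<close>

definition std_normal_mass :: "real \<Rightarrow> real" where
  "std_normal_mass r = cdf std_normal_distribution r - cdf std_normal_distribution (- r)"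

interpretation N: real_distribution std_normal_distribution
  by (rule real_dist_normal_dist)

lemma std_normal_no_atoms: "measure std_normal_distribution {x} = 0"
proof -
  have "absolutely_continuous lborel std_normal_distribution"
    by (rule absolutely_continuousI_density) simp
  moreover have "{x} \<in> null_sets lborel"
    by (rule null_setsI) simp_all
  ultimately have "{x} \<in> null_sets std_normal_distribution"
    by (auto simp: absolutely_continuous_def)
  then show ?thesis
    by (simp add: measure_eq_0_null_sets)
qed

lemma isCont_std_normal_mass: "isCont std_normal_mass r"
proof -
  have c: "isCont (cdf std_normal_distribution) x" for x
    using std_normal_no_atoms by (simp add: N.isCont_cdf)
  have "isCont (\<lambda>r. cdf std_normal_distribution (- r)) r"
    by (rule isCont_o2[OF _ c]) simp
  then show ?thesis
    unfolding std_normal_mass_def[abs_def] by (intro continuous_diff c)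
qed

lemma std_normal_mass_tendsto: "(std_normal_mass \<longlongrightarrow> 1) at_top"
proof -
  have "((\<lambda>r. cdf std_normal_distribution (- r)) \<longlongrightarrow> 0) at_top"
    by (rule filterlim_compose[OF N.cdf_lim_at_bot filterlim_uminus_at_bot_at_top])
  from tendsto_diff[OF N.cdf_lim_at_top_prob this] show ?thesis
    by (simp add: std_normal_mass_def[abs_def])
qed

lemma std_normal_Icc:
  assumes "0 \<le> r"
  shows "measure std_normal_distribution {- r..r} = std_normal_mass r"
proof (cases "r = 0")
  case True
  then show ?thesis
    by (simp add: std_normal_mass_def std_normal_no_atoms)
next
  case False
  have "{- r..r} = {- r} \<union> {- r<..r}"
    using assms by auto
  then have "measure std_normal_distribution {- r..r} = measure std_normal_distribution {- r<..r}"
    using N.finite_measure_Union[of "{- r}" "{- r<..r}"] std_normal_no_atoms by simp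
  then show ?thesis
    using N.cdf_diff_eq[of "- r" r] assms False by (simp add: std_normal_mass_def)
qed

text \<open>The inner radius in the final sandwich has \<open>d\<close> subtracted and may be
  negative, for instance at \<open>t = 0\<close>; the left side is then at most 0.\<close>

lemma std_normal_mass_le: "std_normal_mass r \<le> measure std_normal_distribution {- r..r}"
proof (cases "0 \<le> r")
  case False
  then have "cdf std_normal_distribution r \<le> cdf std_normal_distribution (- r)"
    by (intro N.cdf_nondecreasing) simp
  then show ?thesis
    using False by (simp add: std_normal_mass_def)
qed (simp add: std_normal_Icc)

lemma cdf_chi_square_1: "cdf (chi_square 1) t = (if t < 0 then 0 else std_normal_mass (sqrt t))"
proof -
  let ?N = std_normal_distribution
  have "chi_square 1 = distr (PiM {..<1::nat} (\<lambda>_. ?N)) borel (\<lambda>z. (z 0)\<^sup>2)"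
    unfolding chi_square_def by simp
  also have "\<dots> = distr (distr (PiM {..<1::nat} (\<lambda>_. ?N)) ?N (\<lambda>z. z 0)) borel (\<lambda>x. x\<^sup>2)"
    by (subst distr_distr) (auto simp: comp_def)
  also have "distr (PiM {..<1::nat} (\<lambda>_. ?N)) ?N (\<lambda>z. z 0) = ?N"
    by (rule distr_PiM_component) (auto simp: N.prob_space_axioms)
  finally have "cdf (chi_square 1) t = measure ?N {x. x\<^sup>2 \<le> t}"
    by (simp add: cdf_def measure_distr vimage_def)
  moreover have "{x. x\<^sup>2 \<le> t} = (if t < 0 then {} else {- sqrt t..sqrt t})"
  proof -
    have "x\<^sup>2 \<le> t \<longleftrightarrow> - sqrt t \<le> x \<and> x \<le> sqrt t" if "0 \<le> t" for x
    proof -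
      have "x\<^sup>2 \<le> t \<longleftrightarrow> \<bar>x\<bar> \<le> sqrt t"
        using that by (metis abs_le_square_iff abs_of_nonneg real_sqrt_ge_zero real_sqrt_pow2)
      then show ?thesis
        by (auto simp: abs_le_iff)
    qed
    moreover have "\<not> x\<^sup>2 \<le> t" if "t < 0" for x
      using that zero_le_power2[of x] by linarith
    ultimately show ?thesis
      by auto
  qed
  ultimately show ?thesis
    by (simp add: std_normal_Icc)
qed

section \<open>The typical event and the passage to the limit\<close>

context symmetric_sample
begin

definition jel_sd :: real where
  "jel_sd = 3 * sqrt (\<integral>x. (proj x)\<^sup>2 \<partial>D)"

lemma jel_sd_pos: "0 < jel_sd"
  using proj_nondegenerate by (simp add: jel_sd_def)

lemma jel_sd_square: "jel_sd\<^sup>2 = (\<integral>x. (3 * proj x)\<^sup>2 \<partial>D)"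
  using proj_nondegenerate by (simp add: jel_sd_def power_mult_distrib)

definition zscore :: "nat \<Rightarrow> 'a \<Rightarrow> real" where
  "zscore n \<omega> = (\<Sum>i = 1..n. 3 * proj (X i \<omega>)) / (sqrt n * jel_sd)"

lemma zscore_measurable [measurable]: "zscore n \<in> borel_measurable M"
proof -
  have "(\<lambda>\<omega>. \<Sum>i = 1..n. 3 * proj (X i \<omega>)) \<in> borel_measurable M"
  proof (rule borel_measurable_sum)
    fix i assume "i \<in> {1..n}"
    then have [measurable]: "X i \<in> borel_measurable M"
      by simp
    show "(\<lambda>\<omega>. 3 * proj (X i \<omega>)) \<in> borel_measurable M"
      by measurable
  qed
  then show ?thesis
    unfolding zscore_def[abs_def] by measurable
qed

text \<open>Weak convergence from the central limit theorem, transferred to the interval because its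
  frontier consists of at most two points and the normal law has no atoms.\<close>

lemma zscore_tendsto:
  "(\<lambda>n. prob {\<omega> \<in> space M. \<bar>zscore n \<omega>\<bar> \<le> r}) \<longlonglongrightarrow> measure std_normal_distribution {- r..r}"
proof -
  have w: "weak_conv_m (\<lambda>n. distr M borel (zscore n)) std_normal_distribution"
    unfolding zscore_def[abs_def]
    using integrable_proj_square integrable_proj integral_proj jel_sd_pos jel_sd_square
    by (intro clt) (auto simp: power_mult_distrib)
  have "frontier {- r..r} \<subseteq> {- r, r}"
    by (auto simp: frontier_def)
  then have "measure std_normal_distribution (frontier {- r..r}) \<le> measure std_normal_distribution {- r, r}"
    by (intro N.finite_measure_mono) auto
  also have "\<dots> \<le> measure std_normal_distribution {- r} + measure std_normal_distribution {r}"
    using measure_Un_le[of "{- r}" std_normal_distribution "{r}"] by (simp add: insert_commute)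
  finally have "measure std_normal_distribution (frontier {- r..r}) = 0"
    using std_normal_no_atoms by (simp add: antisym)
  then have "emeasure std_normal_distribution (frontier {- r..r}) = 0"
    by (simp add: N.emeasure_eq_measure)
  then have "(\<lambda>n. measure (distr M borel (zscore n)) {- r..r}) \<longlonglongrightarrow> measure std_normal_distribution {- r..r}"
    using w by (intro weak_conv_imp_continuity_set_conv) (auto intro!: real_dist_normal_dist simp: real_distribution_distr)
  moreover have "measure (distr M borel (zscore n)) {- r..r} = prob {\<omega> \<in> space M. \<bar>zscore n \<omega>\<bar> \<le> r}" for n
    by (auto simp: measure_distr abs_le_iff intro!: arg_cong[where f = prob])
  ultimately show ?thesis
    by simp
qed

text \<open>The hypotheses of \<open>neg2_log_el_ratio_perturbed\<close> for the sample, with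
  \<open>3 * proj\<close> as the linearised pseudo-values. For fixed \<open>d\<close> the first four
  conditions hold with probability tending to 1; the last one fails with a probability tending to
  the normal tail beyond \<open>1 / d\<close>, which is small only for small
  \<open>d\<close>.\<close>

definition typical :: "real \<Rightarrow> nat \<Rightarrow> 'a set" where
  "typical d n = {\<omega> \<in> space M.
     n * ((\<Sum>i = 1..n. pv n i \<omega>) / n - (\<Sum>i = 1..n. 3 * proj (X i \<omega>)) / n)\<^sup>2 < d\<^sup>2 * jel_sd\<^sup>2 \<and>
     (\<Sum>i = 1..n. (pv n i \<omega> - 3 * proj (X i \<omega>))\<^sup>2) / n < d ^ 4 * jel_sd\<^sup>2 \<and>
     \<bar>(\<Sum>i = 1..n. (3 * proj (X i \<omega>))\<^sup>2) / n - jel_sd\<^sup>2\<bar> < d * jel_sd\<^sup>2 \<and>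
     (\<forall>i \<in> {1..n}. \<bar>3 * proj (X i \<omega>)\<bar> < d\<^sup>2 * jel_sd * sqrt n) \<and>
     \<bar>zscore n \<omega>\<bar> \<le> 1 / d}"

lemma eventually_typical:
  assumes d: "0 < d" and e: "0 < e"
  shows "\<forall>\<^sub>F n in sequentially. prob (space M - typical d n) < 1 - std_normal_mass (1 / d) + e"
    and "typical d n \<in> sets M"
proof -
  let ?A1 = "\<lambda>n. {\<omega> \<in> space M. d\<^sup>2 * jel_sd\<^sup>2
      \<le> n * ((\<Sum>i = 1..n. pv n i \<omega>) / n - (\<Sum>i = 1..n. 3 * proj (X i \<omega>)) / n)\<^sup>2}"
  let ?A2 = "\<lambda>n. {\<omega> \<in> space M. d ^ 4 * jel_sd\<^sup>2 \<le> (\<Sum>i = 1..n. (pv n i \<omega> - 3 * proj (X i \<omega>))\<^sup>2) / n}"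
  let ?A3 = "\<lambda>n. {\<omega> \<in> space M. d * jel_sd\<^sup>2 \<le> \<bar>(\<Sum>i = 1..n. (3 * proj (X i \<omega>))\<^sup>2) / n - (\<integral>x. (3 * proj x)\<^sup>2 \<partial>D)\<bar>}"
  let ?A4 = "\<lambda>n. {\<omega> \<in> space M. \<exists>i \<in> {1..n}. d\<^sup>2 * jel_sd * sqrt n \<le> \<bar>3 * proj (X i \<omega>)\<bar>}"
  let ?A5 = "\<lambda>n. space M - {\<omega> \<in> space M. \<bar>zscore n \<omega>\<bar> \<le> 1 / d}"
  have m1: "?A1 n \<in> sets M" and m2: "?A2 n \<in> sets M" and m3: "?A3 n \<in> sets M"
    and m4: "?A4 n \<in> sets M" and m5: "?A5 n \<in> sets M" for n
    by measurable
  have eq: "space M - typical d n = ?A1 n \<union> (?A2 n \<union> (?A3 n \<union> (?A4 n \<union> ?A5 n)))" for n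
    by (auto simp: typical_def not_less jel_sd_square)
  have "typical d n = space M - (space M - typical d n)"
    by (auto simp: typical_def)
  also have "\<dots> \<in> sets M"
    unfolding eq using m1 m2 m3 m4 m5 by blast
  finally show "typical d n \<in> sets M" .
  have le: "prob (space M - typical d n) \<le> prob (?A1 n) + (prob (?A2 n) + (prob (?A3 n) + (prob (?A4 n) + prob (?A5 n))))" for n
    unfolding eq
    by (intro order_trans[OF measure_Un_le] add_left_mono order_refl sets.Un m1 m2 m3 m4 m5)
  have p5: "prob (?A5 n) = 1 - prob {\<omega> \<in> space M. \<bar>zscore n \<omega>\<bar> \<le> 1 / d}" for n
    by (rule prob_compl) measurable
  have i3: "integrable D (\<lambda>x. (3 * proj x)\<^sup>2)"
    using integrable_proj_square by (simp add: power_mult_distrib)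
  have "(\<lambda>n. prob (?A1 n)) \<longlonglongrightarrow> 0"
    using d jel_sd_pos by (intro mean_remainder_negligible) simp
  moreover have "(\<lambda>n. prob (?A2 n)) \<longlonglongrightarrow> 0"
    using d jel_sd_pos by (intro remainder_mean_square_negligible) simp
  moreover have "(\<lambda>n. prob (?A3 n)) \<longlonglongrightarrow> 0"
    using d jel_sd_pos i3 by (intro weak_law) simp_all
  moreover have "(\<lambda>n. prob (?A4 n)) \<longlonglongrightarrow> 0"
    using d jel_sd_pos i3 by (intro max_negligible) simp_all
  moreover have "(\<lambda>n. prob (?A5 n)) \<longlonglongrightarrow> 1 - std_normal_mass (1 / d)"
    using d zscore_tendsto[of "1 / d"] unfolding p5 by (intro tendsto_diff tendsto_const) (simp add: std_normal_Icc)
  ultimately have "(\<lambda>n. prob (?A1 n) + (prob (?A2 n) + (prob (?A3 n) + (prob (?A4 n) + prob (?A5 n)))))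
      \<longlonglongrightarrow> 0 + (0 + (0 + (0 + (1 - std_normal_mass (1 / d)))))"
    by (intro tendsto_add)
  then have "\<forall>\<^sub>F n in sequentially. prob (?A1 n) + (prob (?A2 n) + (prob (?A3 n) + (prob (?A4 n) + prob (?A5 n))))
      < 1 - std_normal_mass (1 / d) + e"
    using e by (intro order_tendstoD(2)) auto
  then show "\<forall>\<^sub>F n in sequentially. prob (space M - typical d n) < 1 - std_normal_mass (1 / d) + e"
    by eventually_elim (rule order.strict_trans1[OF le])
qed

lemma jel_measurable: "{\<omega> \<in> space M. neg2_log (jel_ratio n (\<lambda>i. X i \<omega>)) \<le> ereal t} \<in> sets M"
  using sets_neg2_log_el_ratio_le[of "\<lambda>\<omega> i. pv n i \<omega>" M n t]
  by (simp add: jel_ratio_def pv_def[abs_def] pv_measurable[unfolded pv_def[abs_def]])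

text \<open>On a typical sample the event lies between two events
  \<open>\<bar>zscore n \<omega>\<bar> \<le> r\<close> whose radii depend on \<open>d\<close> and
  both tend to \<open>sqrt t\<close> as \<open>d\<close> tends to 0. Continuity of the normal mass
  selects \<open>d\<close>; then \<open>n\<close> is taken large.\<close>

lemma jel_tendsto:
  "(\<lambda>n. prob {\<omega> \<in> space M. neg2_log (jel_ratio n (\<lambda>i. X i \<omega>)) \<le> ereal t}) \<longlonglongrightarrow> cdf (chi_square 1) t"
proof (cases "t < 0")
  case True
  \<comment> \<open>The ratio never exceeds 1, so the statistic is nonnegative.\<close>
  have "\<not> neg2_log (jel_ratio n x) \<le> ereal t" for n x
  proof
    assume "neg2_log (jel_ratio n x) \<le> ereal t"
    then have "exp (- t / 2) \<le> 1"
      using el_ratio_le_1[of n "pseudo_value n x"]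
      by (simp only: jel_ratio_def neg2_log_le_iff[OF el_ratio_nonneg])
    then show False
      using True by simp
  qed
  then show ?thesis
    unfolding cdf_chi_square_1 using True by simp
next
  case False
  then have t: "0 \<le> t" by simp
  define \<Phi> where "\<Phi> = std_normal_mass"
  let ?T = "\<lambda>n. {\<omega> \<in> space M. neg2_log (jel_ratio n (\<lambda>i. X i \<omega>)) \<le> ereal t}"
  let ?r1 = "\<lambda>d. sqrt (t * (1 + 3 * d) / (1 - 80 * d)) + d"
  let ?r2 = "\<lambda>d. sqrt (t * (1 - 3 * d) / (1 + 80 * d)) - d"
  have "(\<lambda>n. prob (?T n)) \<longlonglongrightarrow> \<Phi> (sqrt t)"
  proof (rule LIMSEQ_I)
    fix e :: real assume e: "0 < e"
    have "(?r1 \<longlongrightarrow> sqrt (t * (1 + 3 * 0) / (1 - 80 * 0)) + 0) (at_right 0)"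
      by (intro tendsto_intros) simp_all
    then have r1: "((\<lambda>d. \<Phi> (?r1 d)) \<longlongrightarrow> \<Phi> (sqrt t)) (at_right 0)"
      unfolding \<Phi>_def using isCont_tendsto_compose[OF isCont_std_normal_mass] by fastforce
    have "(?r2 \<longlongrightarrow> sqrt (t * (1 - 3 * 0) / (1 + 80 * 0)) - 0) (at_right 0)"
      by (intro tendsto_intros) simp_all
    then have r2: "((\<lambda>d. \<Phi> (?r2 d)) \<longlongrightarrow> \<Phi> (sqrt t)) (at_right 0)"
      unfolding \<Phi>_def using isCont_tendsto_compose[OF isCont_std_normal_mass] by fastforce
    have r3: "((\<lambda>d. \<Phi> (1 / d)) \<longlongrightarrow> 1) (at_right 0)"
      unfolding \<Phi>_def using filterlim_compose[OF std_normal_mass_tendsto filterlim_inverse_at_top_right]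
      by (simp add: inverse_eq_divide)
    have "\<forall>\<^sub>F d in at_right 0. \<Phi> (?r1 d) < \<Phi> (sqrt t) + e / 4"
      by (rule order_tendstoD(2)[OF r1]) (use e in simp)
    moreover have "\<forall>\<^sub>F d in at_right 0. \<Phi> (sqrt t) - e / 4 < \<Phi> (?r2 d)"
      by (rule order_tendstoD(1)[OF r2]) (use e in simp)
    moreover have "\<forall>\<^sub>F d in at_right 0. 1 - e / 4 < \<Phi> (1 / d)"
      by (rule order_tendstoD(1)[OF r3]) (use e in simp)
    moreover have "\<forall>\<^sub>F d in at_right 0. d \<in> {0<..<1 / 100 :: real}"
      by (rule eventually_at_right_real) simp
    ultimately have "\<forall>\<^sub>F d in at_right 0. \<Phi> (?r1 d) < \<Phi> (sqrt t) + e / 4 \<and> \<Phi> (sqrt t) - e / 4 < \<Phi> (?r2 d)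
        \<and> 1 - e / 4 < \<Phi> (1 / d) \<and> d \<in> {0<..<1 / 100 :: real}"
      by eventually_elim blast
    then obtain d where d1: "\<Phi> (?r1 d) < \<Phi> (sqrt t) + e / 4" and d2: "\<Phi> (sqrt t) - e / 4 < \<Phi> (?r2 d)"
      and d3: "1 - e / 4 < \<Phi> (1 / d)" and d: "0 < d" "d < 1 / 100"
      using eventually_happens'[OF trivial_limit_at_right_real] by fastforce
    let ?Z = "\<lambda>r n. {\<omega> \<in> space M. \<bar>zscore n \<omega>\<bar> \<le> r}"
    have Z: "?Z r n \<in> sets M" for r n
      by measurable
    have atyp: "space M - typical d n \<in> sets M" for n
      using eventually_typical(2)[OF d(1) e] by blast
    have pert: "neg2_log (jel_ratio n (\<lambda>i. X i \<omega>)) \<le> ereal t \<Longrightarrow> \<bar>zscore n \<omega>\<bar> \<le> ?r1 d"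
      "\<bar>zscore n \<omega>\<bar> \<le> ?r2 d \<Longrightarrow> neg2_log (jel_ratio n (\<lambda>i. X i \<omega>)) \<le> ereal t"
      if "n \<ge> 1" "\<omega> \<in> typical d n" for n \<omega>
    proof -
      have el: "jel_ratio n (\<lambda>i. X i \<omega>) = el_ratio n (\<lambda>i. pv n i \<omega>)"
        by (simp add: jel_ratio_def pv_def)
      note p = neg2_log_el_ratio_perturbed[OF that(1) jel_sd_pos d(1) less_imp_le[OF d(2)] t,
          of "\<lambda>i. pv n i \<omega>" "\<lambda>i. 3 * proj (X i \<omega>)", OF _ _ _ _ zscore_def]
      show "neg2_log (jel_ratio n (\<lambda>i. X i \<omega>)) \<le> ereal t \<Longrightarrow> \<bar>zscore n \<omega>\<bar> \<le> ?r1 d"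
        unfolding el by (rule p(1)) (use that(2) in \<open>auto simp: typical_def\<close>)
      show "\<bar>zscore n \<omega>\<bar> \<le> ?r2 d \<Longrightarrow> neg2_log (jel_ratio n (\<lambda>i. X i \<omega>)) \<le> ereal t"
        unfolding el by (rule p(2)) (use that(2) in \<open>auto simp: typical_def\<close>)
    qed
    have "0 \<le> t * (1 + 3 * d) / (1 - 80 * d)"
      using t d by simp
    then have "0 \<le> ?r1 d"
      using d by simp
    then have "(\<lambda>n. prob (?Z (?r1 d) n)) \<longlonglongrightarrow> \<Phi> (?r1 d)"
      using zscore_tendsto[of "?r1 d"] std_normal_Icc[of "?r1 d"] by (simp only: \<Phi>_def)
    then have "\<forall>\<^sub>F n in sequentially. prob (?Z (?r1 d) n) < \<Phi> (?r1 d) + e / 4"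
      by (rule order_tendstoD(2)) (use e in simp)
    moreover have "\<forall>\<^sub>F n in sequentially. \<Phi> (?r2 d) - e / 4 < prob (?Z (?r2 d) n)"
      by (rule order_tendstoD(1)[OF zscore_tendsto])
        (unfold \<Phi>_def, use e std_normal_mass_le[of "?r2 d"] in linarith)
    moreover have "\<forall>\<^sub>F n in sequentially. prob (space M - typical d n) < 1 - \<Phi> (1 / d) + e / 4"
      unfolding \<Phi>_def by (rule eventually_typical(1)[OF d(1)]) (use e in simp)
    ultimately have "\<forall>\<^sub>F n in sequentially. norm (prob (?T n) - \<Phi> (sqrt t)) < e"
      using eventually_ge_at_top[of 1]
    proof eventually_elim
      case (elim n)
      have "prob (?T n) \<le> prob (?Z (?r1 d) n \<union> (space M - typical d n))"
        by (rule finite_measure_mono) (use pert(1)[OF elim(4)] Z atyp in blast)+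
      also have "\<dots> \<le> prob (?Z (?r1 d) n) + prob (space M - typical d n)"
        by (rule measure_Un_le[OF Z atyp])
      finally have 1: "prob (?T n) \<le> prob (?Z (?r1 d) n) + prob (space M - typical d n)" .
      have "prob (?Z (?r2 d) n) \<le> prob (?T n \<union> (space M - typical d n))"
        by (rule finite_measure_mono) (use pert(2)[OF elim(4)] jel_measurable atyp in blast)+
      also have "\<dots> \<le> prob (?T n) + prob (space M - typical d n)"
        by (rule measure_Un_le[OF jel_measurable atyp])
      finally have 2: "prob (?Z (?r2 d) n) \<le> prob (?T n) + prob (space M - typical d n)" .
      \<comment> \<open>In each direction the error is spent in quarters of \<open>e\<close>: the
        change of radius, the normal approximation, the normal tail beyond \<open>1 / d\<close>, and
        the remaining probability of atypical samples.\<close>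
      show ?case
        using 1 2 elim(1-3) d1 d2 d3 by (simp add: abs_less_iff)
    qed
    then show "\<exists>no. \<forall>n\<ge>no. norm (prob (?T n) - \<Phi> (sqrt t)) < e"
      by (simp add: eventually_sequentially)
  qed
  then show ?thesis
    unfolding cdf_chi_square_1 \<Phi>_def using False by simp
qed

end

text \<open>The reflected law gives \<open>{..y}\<close> the mass of \<open>{2 * m - y..}\<close>.
  Without atoms this is \<open>1 - F (2 * m - y)\<close>, which equals \<open>F y\<close> by the
  symmetry condition at \<open>y - m\<close>; equal distribution functions determine equal
  laws.\<close>

lemma distr_reflect_eq:
  assumes D: "real_distribution D" and atoms: "\<And>x. measure D {x} = 0"
    and sym: "\<And>x. cdf D (m + x) = 1 - cdf D (m - x)"
  shows "distr D borel (\<lambda>x. 2 * m - x) = D"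
proof -
  interpret D: real_distribution D by (rule D)
  have "cdf (distr D borel (\<lambda>x. 2 * m - x)) y = cdf D y" for y
  proof -
    have "cdf (distr D borel (\<lambda>x. 2 * m - x)) y = measure D {2 * m - y..}"
      unfolding cdf_def by (subst measure_distr) (auto intro!: arg_cong[where f = "measure D"])
    also have "{2 * m - y..} = space D - {..<2 * m - y}"
      by auto
    also have "measure D \<dots> = 1 - measure D {..<2 * m - y}"
      by (rule D.prob_compl) simp
    also have "measure D {..<2 * m - y} = cdf D (2 * m - y)"
    proof -
      have "{..2 * m - y} = {..<2 * m - y} \<union> {2 * m - y}"
        by auto
      then show ?thesis
        using D.finite_measure_Union[of "{..<2 * m - y}" "{2 * m - y}"] atoms by (simp add: cdf_def)
    qed
    also have "1 - cdf D (2 * m - y) = cdf D y"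
      using sym[of "y - m"] by simp
    finally show ?thesis .
  qed
  then show ?thesis
    by (intro cdf_unique D D.real_distribution_distr ext) simp_all
qed

theorem theorem3:
  fixes M :: "'a measure"
    and X :: "'a \<Rightarrow> real"
    and Xs :: "nat \<Rightarrow> 'a \<Rightarrow> real"
    and f :: "real \<Rightarrow> real"
    and F :: "real \<Rightarrow> real"
    and \<mu> :: real
  assumes prob: "prob_space M"
    and indep: "prob_space.indep_vars M (\<lambda>_. borel) Xs {1..}"
    and ident: "\<And>i. i \<ge> 1 \<Longrightarrow> distr M borel (Xs i) = distr M borel X"
    and f_nonneg: "\<And>x. f x \<ge> 0"
    and abs_cont: "distributed M lborel X (\<lambda>x. ennreal (f x))"
    and F_def: "F = cdf (distr M borel X)"
    and A1_mean: "integrable M X"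
    and A1_variance: "integrable M (\<lambda>\<omega>. (X \<omega>)\<^sup>2)"
    and \<mu>_def: "\<mu> = prob_space.expectation M X"
    and A2: "\<exists>U. open U \<and> \<mu> \<in> U \<and> continuous_on U f"
    and H0: "symmetric_cdf F"
  shows "conv_in_distr M (\<lambda>n \<omega>. neg2_log (jel_ratio n (\<lambda>i. Xs i \<omega>))) (chi_square 1)"
proof -
  interpret prob_space M by (rule prob)
  let ?D = "distr M borel X"
  have X [measurable]: "X \<in> borel_measurable M"
    using A1_mean by simp
  interpret D: real_distribution ?D
    by (rule real_distribution_distr) simp
  have atoms: "measure ?D {x} = 0" for x
  proof -
    have "distr M lborel X = density lborel (\<lambda>x. ennreal (f x))"
      by (rule distributed_distr_eq_density[OF abs_cont])
    moreover have "absolutely_continuous lborel (density lborel (\<lambda>x. ennreal (f x)))"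
      using distributed_borel_measurable[OF abs_cont] by (intro absolutely_continuousI_density) simp
    ultimately have "null_sets lborel \<subseteq> null_sets (distr M lborel X)"
      by (simp add: absolutely_continuous_def)
    moreover have "{x} \<in> null_sets lborel"
      by (rule null_setsI) simp_all
    moreover have "distr M lborel X = ?D"
      by (rule distr_cong) auto
    ultimately show ?thesis
      by (auto intro: measure_eq_0_null_sets)
  qed
  obtain m where m: "\<And>x. cdf ?D (m + x) = 1 - cdf ?D (m - x)"
    using H0 by (auto simp: symmetric_cdf_def F_def)
  \<comment> \<open>The common law is taken to be that of \<open>X\<close>, so the moment, density
    and symmetry assumptions on \<open>X\<close> pass to the sample through
    \<open>ident\<close>.\<close>
  interpret symmetric_sample M Xs ?D m
  proof unfold_locales
    show "distr ?D borel (\<lambda>x. 2 * m - x) = ?D"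
      using D.real_distribution_axioms atoms m by (rule distr_reflect_eq)
  qed (use indep ident A1_variance atoms in \<open>auto simp: integrable_distr_eq\<close>)
  show ?thesis
    unfolding conv_in_distr_def weak_conv_def using jel_tendsto by simp
qed

end
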